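(* Let $\mathfrak{F}$ be a subgroup-closed saturated formation containing all nilpotent groups, and let $G$ be a finite group with $G\notin\mathfrak{F}$. Then every primary cyclic subgroup of $G$ is absolutely $\mathfrak{F}$-subnormal in $G$ or self-normalizing in $G$ if and only if $G$ is a non-nilpotent group all of whose proper subgroups have prime-power order (the trivial subgroup being allowed). In particular, in this case $G=G'\rtimes\langle x\rangle$, where $G'$ is an elementary abelian $p$-group for some prime $p\in\pi(G)$, and $\langle x\rangle$ is a maximal subgroup of $G$ of order $q$ and a Carter subgroup of $G$ for some prime $q\in\pi(G)$, $q\neq p$.
   Context: All groups are finite. $\pi(G)$ is the set of prime divisors of $|G|$; $G'$ is the derived subgroup of $G$; $A\rtimes B$ is the (internal) semidirect product of a normal subgroup $A$ and a subgroup $B$. A primary cyclic subgroup is a cyclic subgroup of order $r^n$ for some prime $r$ and integer $n\geq 1$ (so it is non-trivial). A formation is a non-empty class of finite groups closed under isomorphisms, quotients and subdirect products. A formation $\mathfrak{F}$ is subgroup-closed if every subgroup of a group in $\mathfrak{F}$ is in $\mathfrak{F}$, and saturated if $G/\Phi(G)\in\mathfrak{F}$ implies $G\in\mathfrak{F}$, where $\Phi(G)$ is the Frattini subgroup. A subgroup $H$ of $G$ is $\mathfrak{F}$-subnormal in $G$ if $H=G$ or there is a chain $H=H_0<H_1<\dots<H_n=G$ with each $H_{i-1}$ a maximal subgroup of $H_i$ and $H_i/(H_{i-1})_{H_i}\in\mathfrak{F}$ for all $i$, where $A_B=\bigcap_{b\in B}A^b$ is the core of $A$ in $B$. A subgroup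 $H$ of $G$ is absolutely $\mathfrak{F}$-subnormal in $G$ if every subgroup $L$ of $G$ containing $H$ is $\mathfrak{F}$-subnormal in $G$. A subgroup $H$ of $G$ is self-normalizing if $N_G(H)=H$, and a Carter subgroup if it is nilpotent and self-normalizing. *)

theory Defs
  imports "HOL-Algebra.Algebra"
begin

section \<open>Subgroup notions\<close>

definition maximal_subgroup :: "'a set \<Rightarrow> ('a, 'b) monoid_scheme \<Rightarrow> bool" where
  "maximal_subgroup M G \<longleftrightarrow>
     subgroup M G \<and> M \<noteq> carrier G \<and>
     (\<forall>K. subgroup K G \<and> M \<subseteq> K \<longrightarrow> K = M \<or> K = carrier G)"

text \<open>Intersecting with the carrier only matters for the trivial group, which has no maximal
  subgroups and is its own Frattini subgroup.\<close>

definition frattini :: "('a, 'b) monoid_scheme \<Rightarrow> 'a set" where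
  "frattini G = carrier G \<inter> \<Inter> {M. maximal_subgroup M G}"

definition core :: "('a, 'b) monoid_scheme \<Rightarrow> 'a set \<Rightarrow> 'a set" where
  "core B A = (\<Inter>b\<in>carrier B. (inv\<^bsub>B\<^esub> b <#\<^bsub>B\<^esub> A) #>\<^bsub>B\<^esub> b)"

primrec lower_central :: "('a, 'b) monoid_scheme \<Rightarrow> nat \<Rightarrow> 'a set" where
  "lower_central G 0 = carrier G"
| "lower_central G (Suc n) =
     generate G (\<Union>x\<in>lower_central G n. \<Union>y\<in>carrier G.
       {x \<otimes>\<^bsub>G\<^esub> y \<otimes>\<^bsub>G\<^esub> inv\<^bsub>G\<^esub> x \<otimes>\<^bsub>G\<^esub> inv\<^bsub>G\<^esub> y})"

definition nilpotent_group :: "('a, 'b) monoid_scheme \<Rightarrow> bool" where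
  "nilpotent_group G \<longleftrightarrow> group G \<and> (\<exists>n. lower_central G n = {\<one>\<^bsub>G\<^esub>})"

definition self_normalizing :: "'a set \<Rightarrow> ('a, 'b) monoid_scheme \<Rightarrow> bool" where
  "self_normalizing H G \<longleftrightarrow> subgroup H G \<and> normalizer G H = H"

definition carter_subgroup :: "'a set \<Rightarrow> ('a, 'b) monoid_scheme \<Rightarrow> bool" where
  "carter_subgroup H G \<longleftrightarrow> nilpotent_group (G\<lparr>carrier := H\<rparr>) \<and> self_normalizing H G"

definition primary_cyclic_subgroup :: "'a set \<Rightarrow> ('a, 'b) monoid_scheme \<Rightarrow> bool" where
  "primary_cyclic_subgroup H G \<longleftrightarrow>
     subgroup H G \<and> cyclic_group (G\<lparr>carrier := H\<rparr>) \<and>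
     (\<exists>r n. Factorial_Ring.prime (r::nat) \<and> n \<ge> 1 \<and> card H = r ^ n)"

definition proper_subgroups_prime_power :: "('a, 'b) monoid_scheme \<Rightarrow> bool" where
  "proper_subgroups_prime_power G \<longleftrightarrow>
     (\<forall>H. subgroup H G \<and> H \<noteq> carrier G \<longrightarrow>
        (\<exists>r n. Factorial_Ring.prime (r::nat) \<and> card H = r ^ n))"

definition elementary_abelian :: "nat \<Rightarrow> ('a, 'b) monoid_scheme \<Rightarrow> bool" where
  "elementary_abelian p E \<longleftrightarrow>
     Factorial_Ring.prime p \<and> comm_group E \<and> (\<forall>x\<in>carrier E. x [^]\<^bsub>E\<^esub> p = \<one>\<^bsub>E\<^esub>)"

definition is_semidirect_product :: "('a, 'b) monoid_scheme \<Rightarrow> 'a set \<Rightarrow> 'a set \<Rightarrow> bool" where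
  "is_semidirect_product G A B \<longleftrightarrow>
     A \<lhd> G \<and> subgroup B G \<and> A \<inter> B = {\<one>\<^bsub>G\<^esub>} \<and> A <#>\<^bsub>G\<^esub> B = carrier G"


section \<open>Classes of finite groups and formations\<close>

text \<open>A class of finite groups, closed under isomorphism, is represented by its members with
  carrier in \<^typ>\<open>nat\<close>.  Nothing is lost, since every finite group has an isomorphic copy there
  (see \<open>ex_nat_copy\<close>); a finite group over any type belongs to the class if such a copy does.\<close>

definition in_class :: "nat monoid set \<Rightarrow> ('a, 'b) monoid_scheme \<Rightarrow> bool" where
  "in_class F G \<longleftrightarrow> (\<exists>H\<in>F. G \<cong> H)"

lemma (in group) ex_nat_copy:
  assumes "finite (carrier G)"
  shows "\<exists>H::nat monoid. group H \<and> G \<cong> H"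
proof -
  obtain f where f: "bij_betw f (carrier G) {0..<card (carrier G)}"
    using ex_bij_betw_finite_nat[OF assms] by blast
  define g where "g = inv_into (carrier G) f"
  define H :: "nat monoid" where
    "H = \<lparr>carrier = f ` carrier G, monoid.mult = (\<lambda>a b. f (g a \<otimes> g b)), one = f \<one>\<rparr>"
  have gf: "g (f x) = x" if "x \<in> carrier G" for x
    using f that by (simp add: g_def bij_betw_inv_into_left)
  have iso: "f \<in> Group.iso G H"
    using f gf unfolding Group.iso_def hom_def by (auto simp: H_def bij_betw_def)
  have "group (H\<lparr>one := f \<one>\<rparr>)"
    using iso by (rule iso_imp_img_group)
  then have "group H" by (simp add: H_def)
  then show ?thesis using iso by (blast intro: is_isoI)
qed

text \<open>A subdirect product of \<open>A\<close> and \<open>B\<close> is a subgroup of \<open>A \<times>\<times> B\<close> projecting onto both factors;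
  subdirect products of finitely many groups are obtained by iteration.\<close>

definition formation :: "nat monoid set \<Rightarrow> bool" where
  "formation F \<longleftrightarrow>
     F \<noteq> {} \<and>
     (\<forall>G\<in>F. group G \<and> finite (carrier G)) \<and>
     (\<forall>G\<in>F. \<forall>H. group H \<and> G \<cong> H \<longrightarrow> H \<in> F) \<and>
     (\<forall>G\<in>F. \<forall>N. N \<lhd> G \<longrightarrow> in_class F (G Mod N)) \<and>
     (\<forall>A\<in>F. \<forall>B\<in>F. \<forall>S. subgroup S (A \<times>\<times> B) \<and> fst ` S = carrier A \<and> snd ` S = carrier B \<longrightarrow>
        in_class F ((A \<times>\<times> B)\<lparr>carrier := S\<rparr>))"

definition subgroup_closed :: "nat monoid set \<Rightarrow> bool" where
  "subgroup_closed F \<longleftrightarrow> (\<forall>G\<in>F. \<forall>H. subgroup H G \<longrightarrow> G\<lparr>carrier := H\<rparr> \<in> F)"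

definition saturated :: "nat monoid set \<Rightarrow> bool" where
  "saturated F \<longleftrightarrow>
     (\<forall>G. group G \<and> finite (carrier G) \<and> in_class F (G Mod frattini G) \<longrightarrow> G \<in> F)"

definition contains_nilpotent_groups :: "nat monoid set \<Rightarrow> bool" where
  "contains_nilpotent_groups F \<longleftrightarrow>
     (\<forall>G. finite (carrier G) \<and> nilpotent_group G \<longrightarrow> G \<in> F)"

text \<open>The chain \<open>K 0, \<dots>, K n\<close> may have length \<open>n = 0\<close>, which is the case \<open>H = G\<close>.\<close>

definition F_subnormal :: "nat monoid set \<Rightarrow> 'a set \<Rightarrow> ('a, 'b) monoid_scheme \<Rightarrow> bool" where
  "F_subnormal F H G \<longleftrightarrow>
     (\<exists>n (K :: nat \<Rightarrow> 'a set).
        K 0 = H \<and> K n = carrier G \<and>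
        (\<forall>i<n. maximal_subgroup (K i) (G\<lparr>carrier := K (Suc i)\<rparr>) \<and>
           in_class F (G\<lparr>carrier := K (Suc i)\<rparr> Mod core (G\<lparr>carrier := K (Suc i)\<rparr>) (K i))))"

definition abs_F_subnormal :: "nat monoid set \<Rightarrow> 'a set \<Rightarrow> ('a, 'b) monoid_scheme \<Rightarrow> bool" where
  "abs_F_subnormal F H G \<longleftrightarrow>
     subgroup H G \<and> (\<forall>L. subgroup L G \<and> H \<subseteq> L \<longrightarrow> F_subnormal F L G)"

end

theory Submission
  imports Defs
begin

text \<open>Since the formation is saturated and does not contain \<open>G\<close>, some maximal subgroup \<open>M\<close> has
  \<open>G / core M\<close> outside the formation.  No subgroup of \<open>M\<close> is then absolutely subnormal, so every
  primary cyclic subgroup of \<open>M\<close> is self-normalizing.  Self-normalizing subgroups of prime order are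
  malnormal, and the conjugates of a malnormal subgroup fill at least half of \<open>G\<close>; hence only one
  prime \<open>r\<close> can occur, and \<open>M\<close> is a Sylow subgroup of order \<open>r\<close>.  For another prime \<open>p\<close>, a Sylow
  \<open>p\<close>-subgroup \<open>P\<close> is subnormal with respect to the formation, which yields a normal complement of
  \<open>M\<close> containing \<open>P\<close> (so neither transfer nor Frobenius' theorem is needed).  By the Frattini argument
  the normalizer of \<open>P\<close> contains a conjugate of the maximal subgroup \<open>M\<close>, so \<open>P\<close> is normal and
  \<open>G = P M\<close>.

  Conversely, let \<open>G\<close> be non-nilpotent with all proper subgroups of prime power order, and suppose
  that no maximal subgroup is normal.  A maximal one among the nontrivial intersections of two maximal
  subgroups grows in both of them under its normalizer, which is impossible.  So all maximal
  subgroups are malnormal, and the same count contradicts the presence of two primes.  Hence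
  \<open>G = P Q\<close> with \<open>P\<close> minimal normal and \<open>Q\<close> of prime order.\<close>

section \<open>Fixed points of p-groups\<close>

text \<open>An orbit with more than one point has, by the orbit-stabilizer theorem, a nontrivial
  power of \<open>p\<close> as its size. All points that are not fixed together therefore contribute
  a multiple of \<open>p\<close>.\<close>

lemma (in group_action) dvd_card_fixed_points_iff:
  assumes p: "Factorial_Ring.prime (p::nat)" and G: "order G = p ^ n" and fin: "finite E"
  shows "p dvd card {x \<in> E. \<forall>g\<in>carrier G. \<phi> g x = x} \<longleftrightarrow> p dvd card E"
proof -
  let ?F = "{x \<in> E. \<forall>g\<in>carrier G. \<phi> g x = x}"
  interpret group G using group_hom group_hom.axioms(1) by auto
  define C where "C = {B \<in> orbits G E \<phi>. card B \<noteq> 1}"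
  have orb: "B = orbit G \<phi> x" if "B \<in> orbits G E \<phi>" "x \<in> B" for B x
  proof -
    have x: "x \<in> E" using that orbits_coverture by blast
    then have "orbit G \<phi> x \<in> orbits G E \<phi>" by (auto simp: orbits_def)
    then show ?thesis using disjoint_union[OF that(1)] orbit_refl[OF x] that(2) by blast
  qed
  have C: "\<Union>C = E - ?F"
  proof (intro equalityI subsetI)
    fix x assume "x \<in> \<Union>C"
    then obtain B where B: "B \<in> orbits G E \<phi>" "card B \<noteq> 1" "x \<in> B" by (auto simp: C_def)
    have x: "x \<in> E" using B orbits_coverture by blast
    have "x \<notin> ?F"
    proof
      assume "x \<in> ?F"
      then have "orbit G \<phi> x \<subseteq> {x}" by (auto simp: orbit_def)
      then have "B = {x}" using orb[OF B(1,3)] B(3) by auto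
      then show False using B(2) by simp
    qed
    then show "x \<in> E - ?F" using x by blast
  next
    fix x assume x: "x \<in> E - ?F"
    then obtain g where g: "g \<in> carrier G" "\<phi> g x \<noteq> x" by blast
    have xx: "x \<in> orbit G \<phi> x" using x orbit_refl by auto
    have "\<phi> g x \<in> orbit G \<phi> x" using g by (auto simp: orbit_def)
    then have "card (orbit G \<phi> x) \<noteq> 1" using g xx by (auto simp: card_1_singleton_iff)
    then have "orbit G \<phi> x \<in> C" using x by (auto simp: C_def orbits_def)
    then show "x \<in> \<Union>C" using xx by blast
  qed
  have "p dvd card (\<Union>C)"
  proof (rule dvd_partition)
    show "finite (\<Union>C)" using C fin by auto
    show "\<forall>c\<in>C. p dvd card c"
    proof
      fix c assume c: "c \<in> C"
      then obtain x where x: "x \<in> E" "c = orbit G \<phi> x" by (auto simp: C_def orbits_def)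
      have "card c dvd p ^ n" using orbit_stabilizer_theorem[OF x(1)] G x(2) by (metis dvd_triv_left)
      then obtain i where i: "card c = p ^ i" using p divides_primepow_nat by blast
      have "i \<noteq> 0" using i c by (auto simp: C_def)
      then show "p dvd card c" using i by simp
    qed
    show "\<forall>c1\<in>C. \<forall>c2\<in>C. c1 \<noteq> c2 \<longrightarrow> c1 \<inter> c2 = {}"
      using disjoint_union by (auto simp: C_def)
  qed
  moreover have "card E = card ?F + card (\<Union>C)"
    using card_Diff_subset[of ?F E] card_mono[of E ?F] fin C by (simp add: finite_subset)
  ultimately show ?thesis by (simp add: dvd_add_left_iff)
qed

section \<open>Action on right cosets and its Sylow-type consequences\<close>

lemma (in group) action_on_rcosets:
  assumes "subgroup K G"
  shows "group_action G (rcosets K) (\<lambda>g. \<lambda>C\<in>rcosets K. C #> inv g)"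
proof -
  \<comment> \<open>The inverse turns right multiplication into a left action, and the restricted
    abstraction is there because \<open>Bij\<close> consists of extensional functions.\<close>
  let ?f = "\<lambda>g. \<lambda>C\<in>rcosets K. C #> inv g"
  have sub: "K \<subseteq> carrier G" using assms subgroup.subset by blast
  have cl: "C #> g \<in> rcosets K" if "C \<in> rcosets K" "g \<in> carrier G" for C g
    using that sub by (auto simp: RCOSETS_def coset_mult_assoc)
  have mul: "(C #> g) #> h = C #> (g \<otimes> h)" if "C \<in> rcosets K" "g \<in> carrier G" "h \<in> carrier G" for C g h
    using that sub by (auto simp: RCOSETS_def coset_mult_assoc m_assoc)
  have one: "C #> \<one> = C" if "C \<in> rcosets K" for C
    using that sub by (auto simp: RCOSETS_def coset_mult_assoc)
  have bij: "?f g \<in> Bij (rcosets K)" if g: "g \<in> carrier G" for g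
  proof -
    have "bij_betw (\<lambda>C. C #> inv g) (rcosets K) (rcosets K)"
      by (rule bij_betw_byWitness[where f' = "\<lambda>C. C #> g"]) (use g in \<open>auto simp: cl mul one\<close>)
    then show ?thesis by (simp add: Bij_def bij_betw_restrict_eq)
  qed
  have "?f \<in> hom G (BijGroup (rcosets K))"
  proof (rule homI)
    show "?f g \<in> carrier (BijGroup (rcosets K))" if "g \<in> carrier G" for g
      using bij[OF that] by (simp add: BijGroup_def)
    show "?f (g \<otimes> h) = ?f g \<otimes>\<^bsub>BijGroup (rcosets K)\<^esub> ?f h" if "g \<in> carrier G" "h \<in> carrier G" for g h
      using that bij by (simp add: BijGroup_def compose_def inv_mult_group mul cl cong: restrict_cong)
  qed
  then show ?thesis
    by (simp add: group_action_def group_hom_def group_hom_axioms_def group_BijGroup is_group)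
qed

lemma (in group) dvd_card_fixed_rcosets_iff:
  assumes H: "subgroup H G" and K: "subgroup K G" and fin: "finite (carrier G)"
    and p: "Factorial_Ring.prime (p::nat)" "card H = p ^ n"
  shows "p dvd card {C \<in> rcosets K. \<forall>h\<in>H. C #> h = C} \<longleftrightarrow> p dvd card (rcosets K)"
proof -
  interpret A: group_action "G\<lparr>carrier := H\<rparr>" "rcosets K" "\<lambda>g. \<lambda>C\<in>rcosets K. C #> inv g"
    using group_action.induced_action[OF action_on_rcosets[OF K] H] .
  have "finite (rcosets K)"
    using fin rcosets_subset_PowG[OF K] finite_subset by blast
  moreover have "order (G\<lparr>carrier := H\<rparr>) = p ^ n" using p by (simp add: order_def)
  \<comment> \<open>The inverse in the action disappears because \<open>H\<close> is closed under
    inverses.\<close>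
  moreover have "{C \<in> rcosets K. \<forall>g\<in>H. C #> inv g = C} = {C \<in> rcosets K. \<forall>h\<in>H. C #> h = C}"
    using H by (metis (no_types, lifting) inv_inv subgroup.m_inv_closed subgroup.mem_carrier)
  ultimately show ?thesis using A.dvd_card_fixed_points_iff[OF p(1)] by (simp cong: conj_cong)
qed

text \<open>This translates fixed cosets into conjugation: \<open>H\<close> fixes
  \<open>K #> g\<close> exactly if \<open>g\<close> conjugates \<open>H\<close> into
  \<open>K\<close>.\<close>

lemma (in group) rcoset_fixed_iff:
  assumes K: "subgroup K G" and gh: "g \<in> carrier G" "h \<in> carrier G"
  shows "K #> g #> h = K #> g \<longleftrightarrow> g \<otimes> h \<otimes> inv g \<in> K"
proof -
  have sub: "K \<subseteq> carrier G" using K subgroup.subset by blast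
  have "K #> g #> h = K #> g \<longleftrightarrow> K #> (g \<otimes> h) = K #> g"
    using gh sub by (simp add: coset_mult_assoc)
  also have "\<dots> \<longleftrightarrow> g \<otimes> h \<in> K #> g"
    using K gh by (metis m_closed repr_independence repr_independenceD)
  also have "\<dots> \<longleftrightarrow> g \<otimes> h \<otimes> inv g \<in> K"
    using subgroup.rcos_module[OF K is_group] gh by simp
  finally show ?thesis .
qed

text \<open>If \<open>p\<close> does not divide the index of \<open>K\<close>, the number of cosets
  fixed by \<open>H\<close> is not divisible by \<open>p\<close> either, so it is not zero.\<close>

lemma (in group) sylow_conj:
  assumes H: "subgroup H G" and K: "subgroup K G" and fin: "finite (carrier G)"
    and p: "Factorial_Ring.prime (p::nat)" "card H = p ^ n" "\<not> p dvd card (rcosets K)"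
  shows "\<exists>g\<in>carrier G. \<forall>h\<in>H. g \<otimes> h \<otimes> inv g \<in> K"
proof -
  have "{C \<in> rcosets K. \<forall>h\<in>H. C #> h = C} \<noteq> {}"
    using dvd_card_fixed_rcosets_iff[OF H K fin p(1,2)] p(3) by (metis card.empty dvd_0_right)
  then obtain g where "g \<in> carrier G" "\<forall>h\<in>H. K #> g #> h = K #> g"
    by (auto simp: RCOSETS_def)
  then show ?thesis using rcoset_fixed_iff[OF K] H by (meson subgroup.mem_carrier)
qed

text \<open>The number of cosets of \<open>H\<close> fixed by \<open>H\<close> is a multiple of
  \<open>p\<close> and \<open>H\<close> itself is one of them. A representative of a second one
  normalizes \<open>H\<close>.\<close>

lemma (in group) normalizing_element_outside_p_subgroup:
  assumes H: "subgroup H G" and fin: "finite (carrier G)"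
    and p: "Factorial_Ring.prime (p::nat)" "card H = p ^ n" "p dvd card (rcosets H)"
  shows "\<exists>g\<in>carrier G - H. \<forall>h\<in>H. g \<otimes> h \<otimes> inv g \<in> H"
proof -
  let ?F = "{C \<in> rcosets H. \<forall>h\<in>H. C #> h = C}"
  have "p dvd card ?F" using dvd_card_fixed_rcosets_iff[OF H H fin p(1,2)] p(3) by blast
  then have "card ?F \<noteq> 1" using p(1) by auto
  moreover have "H \<in> ?F"
    using H is_group subgroup.subgroup_in_rcosets subgroup.rcos_const by fastforce
  ultimately obtain C where C: "C \<in> ?F" "C \<noteq> H"
    by (metis (no_types, lifting) is_singletonI' is_singleton_altdef empty_iff)
  then obtain g where g: "g \<in> carrier G" "C = H #> g" "\<forall>h\<in>H. H #> g #> h = H #> g"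
    by (auto simp: RCOSETS_def)
  have "g \<notin> H" using C g H by (meson coset_join2)
  then show ?thesis using rcoset_fixed_iff[OF H g(1)] g H by (meson DiffI subgroup.mem_carrier)
qed

text \<open>The fixed points of conjugation form the centre; their number is divisible by
  \<open>p\<close>, and the identity is among them.\<close>

lemma (in group) p_group_center_nontrivial:
  assumes p: "Factorial_Ring.prime (p::nat)" "order G = p ^ n" "n > 0"
  shows "\<exists>x\<in>carrier G - {\<one>}. \<forall>g\<in>carrier G. g \<otimes> x = x \<otimes> g"
proof -
  interpret A: group_action G "carrier G" "\<lambda>g. \<lambda>h\<in>carrier G. g \<otimes> h \<otimes> inv g"
    by (rule action_by_conjugation)
  let ?F = "{x \<in> carrier G. \<forall>g\<in>carrier G. g \<otimes> x \<otimes> inv g = x}"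
  have fin: "finite (carrier G)"
    using p by (metis order_gt_0_iff_finite prime_gt_0_nat zero_less_power)
  have "{x \<in> carrier G. \<forall>g\<in>carrier G. (\<lambda>h\<in>carrier G. g \<otimes> h \<otimes> inv g) x = x} = ?F" by auto
  then have "p dvd card ?F"
    using A.dvd_card_fixed_points_iff[OF p(1,2) fin] p(2,3) by (simp add: order_def)
  then have "card ?F \<noteq> 1" using p(1) by auto
  moreover have "\<one> \<in> ?F" by simp
  ultimately obtain x where x: "x \<in> ?F" "x \<noteq> \<one>"
    by (metis (no_types, lifting) is_singletonI' is_singleton_altdef empty_iff)
  have "g \<otimes> x = x \<otimes> g" if g: "g \<in> carrier G" for g
  proof -
    have xc: "x \<in> carrier G" and fix_x: "g \<otimes> x \<otimes> inv g = x" using x g by auto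
    have "g \<otimes> x = g \<otimes> x \<otimes> inv g \<otimes> g" using g xc by (simp add: m_assoc)
    then show ?thesis using fix_x by simp
  qed
  then show ?thesis using x by blast
qed

section \<open>Subgroups of finite groups\<close>

context group begin

lemma pow_card_subgroup:
  assumes "subgroup H G" "x \<in> H" shows "x [^] card H = \<one>"
  using group.pow_order_eq_1[OF subgroup_imp_group[OF assms(1)], of x] assms(2)
  by (simp add: order_def flip: nat_pow_consistent)

lemma ord_dvd_card_subgroup:
  assumes "subgroup H G" "x \<in> H" shows "ord x dvd card H"
  using pow_card_subgroup[OF assms] pow_eq_id subgroup.mem_carrier[OF assms] by blast

lemma card_subgroup_dvd:
  assumes "subgroup H G" "subgroup K G" "H \<subseteq> K" shows "card H dvd card K"
  using group.lagrange[OF subgroup_imp_group[OF assms(2)] subgroup_incl[OF assms]]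
  by (simp add: order_def) (metis dvd_triv_right)

lemma card_subgroup_dvd_order:
  assumes "subgroup H G" shows "card H dvd order G"
  using lagrange[OF assms] by (metis dvd_triv_right)

text \<open>Sylow's existence theorem is applied inside \<open>H\<close> with exponent 1; the
  exponent there need not be the largest possible one.\<close>

lemma cauchy:
  assumes fin: "finite (carrier G)" and H: "subgroup H G" and p: "Factorial_Ring.prime (p::nat)" "p dvd card H"
  shows "\<exists>x\<in>H. ord x = p"
proof -
  have "order (G\<lparr>carrier := H\<rparr>) = p ^ 1 * (card H div p)" using p(2) by (simp add: order_def)
  then obtain K where K: "subgroup K (G\<lparr>carrier := H\<rparr>)" "card K = p ^ 1"
    using sylow_thm[OF p(1) subgroup_imp_group[OF H], of 1] fin H
    by (auto dest: finite_subset[OF subgroup.subset])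
  have KG: "subgroup K G" and KH: "K \<subseteq> H" using incl_subgroup[OF H K(1)] subgroup.subset[OF K(1)] by auto
  have "card K \<noteq> 1" using K(2) p(1) by auto
  then obtain x where x: "x \<in> K" "x \<noteq> \<one>"
    by (metis is_singletonI' is_singleton_altdef empty_iff subgroup.one_closed[OF KG])
  have "ord x dvd p" using ord_dvd_card_subgroup[OF KG x(1)] K(2) by simp
  moreover have "ord x \<noteq> 1" using x ord_eq_1 subgroup.mem_carrier[OF KG] by blast
  ultimately have "ord x = p" using p(1) prime_nat_iff by blast
  then show ?thesis using x KH by blast
qed

lemma generate_singleton:
  assumes "x \<in> carrier G"
  shows "subgroup (generate G {x}) G" "x \<in> generate G {x}" "card (generate G {x}) = ord x"
  using assms generate_is_subgroup[of "{x}"] generate_pow_card[OF assms] by (auto intro: generate.incl)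

lemma generate_singleton_subset:
  assumes "subgroup H G" "x \<in> H" shows "generate G {x} \<subseteq> H"
  using assms generate_subgroup_incl by auto

lemma subgroup_prime_card_generate:
  assumes fin: "finite (carrier G)" and H: "subgroup H G" "Factorial_Ring.prime (card H)" and x: "x \<in> H" "x \<noteq> \<one>"
  shows "generate G {x} = H" "ord x = card H"
proof -
  have xc: "x \<in> carrier G" using subgroup.mem_carrier[OF H(1) x(1)] .
  have "ord x dvd card H" using ord_dvd_card_subgroup[OF H(1) x(1)] .
  moreover have "ord x \<noteq> 1" using x ord_eq_1 xc by blast
  ultimately show o: "ord x = card H" using H(2) prime_nat_iff by blast
  have "finite H" using H fin finite_subset subgroup.subset by blast
  then show "generate G {x} = H"
    using o generate_singleton(3)[OF xc] generate_singleton_subset[OF H(1) x(1)] by (simp add: card_subset_eq)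
qed

lemma primary_cyclic_subgroup_generate:
  assumes "x \<in> carrier G" "ord x = r ^ n" "Factorial_Ring.prime (r::nat)" "n \<ge> 1"
  shows "primary_cyclic_subgroup (generate G {x}) G"
proof -
  let ?H = "generate G {x}"
  have H: "subgroup ?H G" "x \<in> ?H" "card ?H = r ^ n" using generate_singleton assms by auto
  \<comment> \<open>Cyclicity is a statement about \<open>?H\<close> as a group of its own, so
    \<open>x\<close> has to generate it from within.\<close>
  have "generate (G\<lparr>carrier := ?H\<rparr>) {x} = generate G {x}"
    using generate_consistent[of "{x}" ?H] H by simp
  then have "subgroup_generated (G\<lparr>carrier := ?H\<rparr>) {x} = G\<lparr>carrier := ?H\<rparr>"
    using H by (simp add: subgroup_generated_def)
  then have "cyclic_group (G\<lparr>carrier := ?H\<rparr>)" using H(2) unfolding cyclic_group_def by auto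
  then show ?thesis unfolding primary_cyclic_subgroup_def using H assms by blast
qed

text \<open>The order of the image of \<open>x\<close> in the quotient divides both \<open>k\<close>
  and the index, so the image is trivial.\<close>

lemma coprime_index_imp_mem_normal:
  assumes N: "N \<lhd> G" and x: "x \<in> carrier G" "x [^] (k::nat) = \<one>" and cop: "coprime k (card (rcosets N))"
  shows "x \<in> N"
proof -
  interpret N: normal N G by fact
  interpret Q: group "G Mod N" by (rule N.factorgroup_is_group)
  have c: "N #> x \<in> carrier (G Mod N)" using x by (auto simp: carrier_FactGroup)
  have "(N #> x) [^]\<^bsub>G Mod N\<^esub> k = \<one>\<^bsub>G Mod N\<^esub>" using N.FactGroup_pow[OF x(1)] x(2) N.subset by simp
  then have "Q.ord (N #> x) dvd k" using Q.pow_eq_id[OF c] by blast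
  moreover have "Q.ord (N #> x) dvd card (rcosets N)"
    using Q.ord_dvd_group_order[OF c] by (simp add: order_def FactGroup_def)
  ultimately have "Q.ord (N #> x) = 1" using cop coprime_common_divisor_nat by blast
  then have "N #> x = N" using Q.ord_eq_1[OF c] by simp
  then show ?thesis using x(1) N.subgroup_axioms rcos_self by blast
qed

lemma coprime_index_imp_subset_normal:
  assumes "N \<lhd> G" "subgroup H G" "coprime (card H) (card (rcosets N))"
  shows "H \<subseteq> N"
  using coprime_index_imp_mem_normal[OF assms(1) _ pow_card_subgroup[OF assms(2)] assms(3)]
    subgroup.mem_carrier[OF assms(2)] by auto

lemma coprime_card_imp_Int_trivial:
  assumes "subgroup H G" "subgroup K G" "coprime (card H) (card K)"
  shows "H \<inter> K = {\<one>}"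
proof
  show "H \<inter> K \<subseteq> {\<one>}"
  proof
    fix x assume x: "x \<in> H \<inter> K"
    then have "ord x = 1"
      using ord_dvd_card_subgroup[OF assms(1), of x] ord_dvd_card_subgroup[OF assms(2), of x]
        coprime_common_divisor_nat[OF assms(3)] by simp
    then show "x \<in> {\<one>}" using x ord_eq_1[of x] subgroup.mem_carrier[OF assms(1)] by simp
  qed
qed (use assms in \<open>auto simp: subgroup.one_closed\<close>)

section \<open>Conjugation and normalizers\<close>

lemma conj_image_eq: 
  assumes "g \<in> carrier G" "H \<subseteq> carrier G"
  shows "g <# H #> inv g = (\<lambda>h. g \<otimes> h \<otimes> inv g) ` H"
  by (auto simp: l_coset_def r_coset_def)

lemma conj_iso:
  assumes g: "g \<in> carrier G" shows "(\<lambda>h. g \<otimes> h \<otimes> inv g) \<in> iso G G"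
proof -
  have "(\<lambda>h. g \<otimes> h \<otimes> inv g) \<in> hom G G"
  proof (rule homI)
    fix x y assume "x \<in> carrier G" "y \<in> carrier G"
    then show "g \<otimes> (x \<otimes> y) \<otimes> inv g = g \<otimes> x \<otimes> inv g \<otimes> (g \<otimes> y \<otimes> inv g)"
      using g by (simp add: m_assoc inv_solve_left)
  qed (use g in simp)
  moreover have "bij_betw (\<lambda>h. g \<otimes> h \<otimes> inv g) (carrier G) (carrier G)"
    using conjugation_is_bij[OF g] by (simp add: bij_betw_restrict_eq)
  ultimately show ?thesis by (simp add: iso_def)
qed

lemma conj_subgroup:
  assumes "g \<in> carrier G" "subgroup H G"
  shows "subgroup ((\<lambda>h. g \<otimes> h \<otimes> inv g) ` H) G" "card ((\<lambda>h. g \<otimes> h \<otimes> inv g) ` H) = card H"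
proof -
  show "subgroup ((\<lambda>h. g \<otimes> h \<otimes> inv g) ` H) G"
    using subgroup_conjugation_is_surj2[OF assms] conj_image_eq[OF assms(1)] assms(2) subgroup.subset by metis
  have "inj_on (\<lambda>h. g \<otimes> h \<otimes> inv g) H"
    using conj_iso[OF assms(1)] assms(2) by (meson iso_iff inj_on_subset subgroup.subset)
  then show "card ((\<lambda>h. g \<otimes> h \<otimes> inv g) ` H) = card H" by (rule card_image)
qed

text \<open>In a finite group one inclusion suffices, because a conjugate of \<open>H\<close> has as
  many elements as \<open>H\<close>.\<close>

lemma mem_normalizer_iff:
  assumes fin: "finite (carrier G)" and H: "subgroup H G"
  shows "g \<in> normalizer G H \<longleftrightarrow> g \<in> carrier G \<and> (\<forall>h\<in>H. g \<otimes> h \<otimes> inv g \<in> H)"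
proof (cases "g \<in> carrier G")
  case g: True
  have sub: "H \<subseteq> carrier G" "finite H" using H fin subgroup.subset finite_subset by blast+
  have "g \<in> normalizer G H \<longleftrightarrow> (\<lambda>h. g \<otimes> h \<otimes> inv g) ` H = H"
    using sub g conj_image_eq[OF g sub(1)] by (simp add: normalizer_def stabilizer_def)
  also have "\<dots> \<longleftrightarrow> (\<lambda>h. g \<otimes> h \<otimes> inv g) ` H \<subseteq> H"
    using conj_subgroup(2)[OF g H] sub(2) card_subset_eq by blast
  finally show ?thesis using g by auto
qed (simp add: normalizer_def stabilizer_def)

lemma subset_normalizer:
  assumes "finite (carrier G)" "subgroup H G" shows "H \<subseteq> normalizer G H"
  using assms by (auto simp: mem_normalizer_iff subgroup.mem_carrier subgroup.m_closed subgroup.m_inv_closed)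

lemma normal_iff_normalizer:
  assumes "finite (carrier G)" "subgroup H G" shows "H \<lhd> G \<longleftrightarrow> normalizer G H = carrier G"
  using assms mem_normalizer_iff[OF assms] by (auto simp: normal_inv_iff)

lemma set_mult_normal_subgroup:
  assumes "N \<lhd> G" "subgroup H G"
  shows "subgroup (N <#> H) G" "N \<subseteq> N <#> H" "H \<subseteq> N <#> H"
proof -
  show "subgroup (N <#> H) G"
    using mult_norm_subgroup[OF assms] commut_normal[OF assms(2,1)] by simp
  have *: "subgroup N G" using assms(1) normal_imp_subgroup by blast
  show "N \<subseteq> N <#> H" unfolding set_mult_def
    using subgroup.one_closed[OF assms(2)] subgroup.mem_carrier[OF *] by fastforce
  show "H \<subseteq> N <#> H" unfolding set_mult_def
    using subgroup.one_closed[OF *] subgroup.mem_carrier[OF assms(2)] by fastforce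
qed

lemma card_set_mult_le:
  assumes "finite A" "finite B" shows "card (A <#> B) \<le> card A * card B"
proof -
  have "A <#> B = (\<lambda>(a, b). a \<otimes> b) ` (A \<times> B)" by (auto simp: set_mult_def)
  then show ?thesis using assms by (metis card_cartesian_product card_image_le finite_cartesian_product)
qed

section \<open>Maximal subgroups\<close>

lemma ex_maximal_subgroup:
  assumes "finite (carrier G)" "subgroup H G" "H \<noteq> carrier G"
  shows "\<exists>M. maximal_subgroup M G \<and> H \<subseteq> M"
proof -
  let ?A = "{K. subgroup K G \<and> K \<noteq> carrier G \<and> H \<subseteq> K}"
  have "finite ?A" using assms(1) by (intro finite_subset[of ?A "Pow (carrier G)"]) (auto dest: subgroup.subset)
  moreover have "H \<in> ?A" using assms by blast
  ultimately obtain M where "M \<in> ?A" "\<And>K. K \<in> ?A \<Longrightarrow> M \<subseteq> K \<Longrightarrow> M = K"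
    using finite_has_maximal[of ?A] by (metis (no_types, lifting) empty_iff)
  then show ?thesis unfolding maximal_subgroup_def by blast
qed

lemma maximal_subgroup_imp_subgroup: "maximal_subgroup M G \<Longrightarrow> subgroup M G"
  by (simp add: maximal_subgroup_def)

text \<open>The normalizer of \<open>M\<close> is a subgroup above \<open>M\<close>, so it is either
  \<open>M\<close> or everything.\<close>

lemma maximal_subgroup_self_normalizing:
  assumes "finite (carrier G)" "maximal_subgroup M G" "\<not> M \<lhd> G"
  shows "self_normalizing M G"
proof -
  have M: "subgroup M G" using assms(2) by (simp add: maximal_subgroup_def)
  have "subgroup (normalizer G M) G" using normalizer_imp_subgroup[OF subgroup.subset[OF M]] .
  then have "normalizer G M = M \<or> normalizer G M = carrier G"
    using assms(2) subset_normalizer[OF assms(1) M] by (simp add: maximal_subgroup_def)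
  then show ?thesis
    using assms(3) normal_iff_normalizer[OF assms(1) M] M by (auto simp: self_normalizing_def)
qed

lemma self_normalizing_imp_not_normal:
  assumes "finite (carrier G)" "self_normalizing H G" "H \<noteq> carrier G" shows "\<not> H \<lhd> G"
  using assms normal_iff_normalizer[OF assms(1), of H] by (auto simp: self_normalizing_def)

text \<open>An overgroup of the image is pulled back along \<open>f\<close> to an overgroup of
  \<open>M\<close>. The lemma serves for conjugates of maximal subgroups and for copies of
  \<open>G\<close> over other types.\<close>

lemma maximal_subgroup_iso_image:
  assumes f: "f \<in> iso G K" and K: "group K" and M: "maximal_subgroup M G"
  shows "maximal_subgroup (f ` M) K"
proof -
  interpret f: group_hom G K f
    using f K by (simp add: group_hom_def group_hom_axioms_def iso_def is_group)
  have bij: "bij_betw f (carrier G) (carrier K)" using f by (simp add: iso_def)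
  have sub: "M \<subseteq> carrier G" using M maximal_subgroup_imp_subgroup subgroup.subset by blast
  show ?thesis unfolding maximal_subgroup_def
  proof (intro conjI allI impI)
    show "subgroup (f ` M) K" using M by (simp add: maximal_subgroup_def f.subgroup_img_is_subgroup)
    show "f ` M \<noteq> carrier K"
      using bij M sub unfolding maximal_subgroup_def bij_betw_def by (metis inj_on_image_eq_iff subset_refl)
    fix L assume L: "subgroup L K \<and> f ` M \<subseteq> L"
    let ?L = "{x \<in> carrier G. f x \<in> L}"
    have img: "f ` ?L = L" using L bij subgroup.subset[of L K] by (fastforce simp: bij_betw_def)
    have "subgroup ?L G"
      using L by (auto intro!: subgroup.intro simp: subgroup.m_closed subgroup.one_closed subgroup.m_inv_closed)
    moreover have "M \<subseteq> ?L" using L sub by auto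
    ultimately have "?L = M \<or> ?L = carrier G" using M unfolding maximal_subgroup_def by blast
    then have "f ` ?L = f ` M \<or> f ` ?L = f ` carrier G" by (elim disjE) simp_all
    then show "L = f ` M \<or> L = carrier K" unfolding img using bij by (simp add: bij_betw_def)
  qed
qed

end

section \<open>Malnormal subgroups\<close>

text \<open>This is the condition on Frobenius complements, stated on elements. The trivial subgroup
  and the whole group satisfy it too, so nontriviality is a separate hypothesis below.\<close>

definition malnormal :: "'a set \<Rightarrow> ('a, 'b) monoid_scheme \<Rightarrow> bool" where
  "malnormal H G \<longleftrightarrow> subgroup H G \<and>
     (\<forall>g\<in>carrier G - H. \<forall>h\<in>H. g \<otimes>\<^bsub>G\<^esub> h \<otimes>\<^bsub>G\<^esub> inv\<^bsub>G\<^esub> g \<in> H \<longrightarrow> h = \<one>\<^bsub>G\<^esub>)"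

context group begin

text \<open>Count the pairs (g, h) with h nontrivial in \<open>H\<close>. At most |H| of them give
  the same conjugate, since g is determined up to a left coset of \<open>H\<close> and then
  determines h. So there are at least |G| (|H| - 1) / |H| conjugates, which is at least half of
  |G|.\<close>

lemma malnormal_conjugates_card:
  assumes fin: "finite (carrier G)" and H: "malnormal H G" "H \<noteq> {\<one>}"
  shows "order G \<le> 2 * card ((\<lambda>(g, h). g \<otimes> h \<otimes> inv g) ` (carrier G \<times> (H - {\<one>})))"
proof -
  let ?A = "carrier G \<times> (H - {\<one>})" and ?f = "\<lambda>(g, h). g \<otimes> h \<otimes> inv g"
  have sH: "subgroup H G" using H by (simp add: malnormal_def)
  have finH: "finite H" and HG: "H \<subseteq> carrier G" using sH fin subgroup.subset finite_subset by blast+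
  have one: "\<one> \<in> H" using sH subgroup.one_closed by blast
  have fA: "finite ?A" using fin finH by simp
  have fib: "card {a \<in> ?A. ?f a = u} \<le> card H" if "u \<in> ?f ` ?A" for u
  proof -
    obtain g0 h0 where g0: "g0 \<in> carrier G" "h0 \<in> H" "u = g0 \<otimes> h0 \<otimes> inv g0" using \<open>u \<in> _\<close> by auto
    have inj: "inj_on fst {a \<in> ?A. ?f a = u}"
    proof (rule inj_onI)
      fix a b assume ab: "a \<in> {a \<in> ?A. ?f a = u}" "b \<in> {a \<in> ?A. ?f a = u}" "fst a = fst b"
      then obtain g h h' where *: "a = (g, h)" "b = (g, h')" by (metis prod.collapse)
      have "g \<in> carrier G" "h \<in> carrier G" "h' \<in> carrier G" "g \<otimes> h \<otimes> inv g = g \<otimes> h' \<otimes> inv g"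
        using ab HG * by auto
      then show "a = b" using * by (metis inv_closed m_closed r_cancel l_cancel)
    qed
    have img: "fst ` {a \<in> ?A. ?f a = u} \<subseteq> (\<lambda>k. g0 \<otimes> k) ` H"
    proof
      fix g assume "g \<in> fst ` {a \<in> ?A. ?f a = u}"
      then obtain a where "a \<in> ?A" "?f a = u" "fst a = g" by blast
      then obtain h where *: "g \<in> carrier G" "h \<in> H" "h \<noteq> \<one>" "g \<otimes> h \<otimes> inv g = u"
        by (cases a, simp, blast)
      \<comment> \<open>This \<open>k\<close> conjugates the nontrivial element \<open>h\<close> of
        \<open>H\<close> to \<open>h0\<close> in \<open>H\<close>, so malnormality puts it into
        \<open>H\<close>.\<close>
      define k where "k = inv g0 \<otimes> g"
      have hc: "h \<in> carrier G" "h0 \<in> carrier G" using * g0 HG by auto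
      have k: "k \<in> carrier G" "g = g0 \<otimes> k" using * g0 by (auto simp: k_def m_assoc[symmetric])
      have "k \<otimes> h \<otimes> inv k = inv g0 \<otimes> (g \<otimes> h \<otimes> inv g) \<otimes> g0"
        using *(1) g0(1) hc by (simp add: k_def inv_mult_group m_assoc)
      also have "\<dots> = h0" unfolding *(4) g0(3) using g0(1) hc by (simp add: m_assoc inv_solve_left')
      finally have "k \<in> H" using H(1) * k(1) g0(2) unfolding malnormal_def by blast
      then show "g \<in> (\<lambda>k. g0 \<otimes> k) ` H" using k by blast
    qed
    have "card {a \<in> ?A. ?f a = u} \<le> card ((\<lambda>k. g0 \<otimes> k) ` H)"
      by (rule card_inj_on_le[OF inj img finite_imageI[OF finH]])
    also have "\<dots> \<le> card H" by (rule card_image_le[OF finH])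
    finally show ?thesis .
  qed
  have "card ?A = (\<Sum>u\<in>?f ` ?A. card {a \<in> ?A. ?f a = u})"
    by (simp only: card_eq_sum sum.group[OF fA finite_imageI[OF fA] subset_refl])
  also have "\<dots> \<le> card (?f ` ?A) * card H"
    using sum_bounded_above[of "?f ` ?A" "\<lambda>u. card {a \<in> ?A. ?f a = u}" "card H"] fib by (simp add: mult.commute)
  finally have le: "order G * (card H - 1) \<le> card (?f ` ?A) * card H"
    using finH one by (simp add: card_cartesian_product order_def)
  have h2: "card H \<ge> 2"
    using finH one H(2) card_1_singleton_iff[of H]
    by (metis card_gt_0_iff empty_iff less_2_cases_iff linorder_not_less singleton_iff less_irrefl One_nat_def)
  have "order G * card H \<le> order G * (2 * (card H - 1))" using h2 by (intro mult_le_mono2) auto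
  also have "\<dots> \<le> 2 * card (?f ` ?A) * card H" using le by simp
  finally show ?thesis using h2 by simp
qed

text \<open>The conjugates of the nontrivial elements of \<open>H\<close> and those of
  \<open>K\<close> are disjoint by coprimality, and each family fills at least half of
  \<open>G\<close>. No room remains for the identity, which lies in neither.\<close>

lemma malnormal_not_coprime:
  assumes fin: "finite (carrier G)"
    and H: "malnormal H G" "H \<noteq> {\<one>}" and K: "malnormal K G" "K \<noteq> {\<one>}"
  shows "\<not> coprime (card H) (card K)"
proof
  assume cop: "coprime (card H) (card K)"
  let ?f = "\<lambda>(g, h). g \<otimes> h \<otimes> inv g"
  let ?U = "?f ` (carrier G \<times> (H - {\<one>}))" and ?V = "?f ` (carrier G \<times> (K - {\<one>}))"
  have sH: "subgroup H G" and sK: "subgroup K G" using H K by (auto simp: malnormal_def)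
  have sub: "?U \<subseteq> carrier G - {\<one>}" "?V \<subseteq> carrier G - {\<one>}"
    using subgroup.mem_carrier[OF sH] subgroup.mem_carrier[OF sK]
    by (auto simp: inv_solve_right' )
  have "?U \<inter> ?V = {}"
  proof (rule ccontr)
    assume "?U \<inter> ?V \<noteq> {}"
    then obtain g h k l where *: "g \<in> carrier G" "h \<in> H" "h \<noteq> \<one>" "k \<in> carrier G" "l \<in> K" "l \<noteq> \<one>"
      "g \<otimes> h \<otimes> inv g = k \<otimes> l \<otimes> inv k" by force
    note 1 = conj_subgroup[OF *(1) sH] and 2 = conj_subgroup[OF *(4) sK]
    have "g \<otimes> h \<otimes> inv g \<in> (\<lambda>h. g \<otimes> h \<otimes> inv g) ` H \<inter> (\<lambda>h. k \<otimes> h \<otimes> inv k) ` K"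
      using *(2,5) unfolding *(7)[symmetric] by (metis *(7) IntI imageI)
    then have "g \<otimes> h \<otimes> inv g = \<one>"
      using coprime_card_imp_Int_trivial[OF 1(1) 2(1)] 1(2) 2(2) cop by auto
    moreover have "g \<otimes> h \<otimes> inv g \<in> carrier G - {\<one>}" using sub(1) * by blast
    ultimately show False by blast
  qed
  moreover have "finite ?U" "finite ?V" using sub fin finite_subset by blast+
  ultimately have "card ?U + card ?V = card (?U \<union> ?V)" by (simp add: card_Un_disjoint)
  also have "\<dots> \<le> card (carrier G - {\<one>})" using sub fin by (intro card_mono) auto
  also have "\<dots> < order G" using fin unfolding order_def by (intro psubset_card_mono) auto
  finally show False using malnormal_conjugates_card[OF fin H] malnormal_conjugates_card[OF fin K] by linarith
qed

text \<open>Each nontrivial element of a group of prime order generates it. If \<open>g\<close>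
  conjugates one of them into \<open>H\<close>, it conjugates all of \<open>H\<close> into
  \<open>H\<close>, so it lies in the normalizer.\<close>

lemma malnormal_of_self_normalizing_prime_card:
  assumes fin: "finite (carrier G)" and H: "self_normalizing H G" "Factorial_Ring.prime (card H)"
  shows "malnormal H G"
proof -
  have sH: "subgroup H G" using H by (simp add: self_normalizing_def)
  have "h = \<one>" if *: "g \<in> carrier G - H" "h \<in> H" "g \<otimes> h \<otimes> inv g \<in> H" for g h
  proof (rule ccontr)
    assume "h \<noteq> \<one>"
    then have gen: "generate G {h} = H" using subgroup_prime_card_generate[OF fin sH H(2)] * by blast
    let ?C = "{x \<in> carrier G. g \<otimes> x \<otimes> inv g \<in> H}"
    have g: "g \<in> carrier G" using * by blast
    interpret f: group_hom G G "\<lambda>h. g \<otimes> h \<otimes> inv g"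
      using conj_iso[OF g] by (simp add: group_hom_def group_hom_axioms_def iso_def is_group)
    have "subgroup ?C G"
      using sH f.hom_mult f.hom_one f.hom_inv
      by (auto intro!: subgroup.intro simp: subgroup.m_closed subgroup.one_closed subgroup.m_inv_closed simp del: f.hom_mult f.hom_inv) 
    moreover have "h \<in> ?C" using * subgroup.mem_carrier[OF sH] by blast
    ultimately have "H \<subseteq> ?C" using generate_singleton_subset gen by blast
    then have "g \<in> normalizer G H" using mem_normalizer_iff[OF fin sH] g by blast
    then show False using H(1) * by (simp add: self_normalizing_def)
  qed
  then show ?thesis using sH by (auto simp: malnormal_def)
qed

end

section \<open>Nilpotency\<close>

context group begin

text \<open>The set is the preimage of the centre of \<open>G Mod D\<close>. Describing it by
  commutators avoids computing with cosets.\<close>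

lemma central_mod_normal:
  assumes D: "D \<lhd> G"
  shows "{x \<in> carrier G. \<forall>y\<in>carrier G. x \<otimes> y \<otimes> inv x \<otimes> inv y \<in> D} \<lhd> G" (is "?Z \<lhd> G")
    and "D \<subseteq> {x \<in> carrier G. \<forall>y\<in>carrier G. x \<otimes> y \<otimes> inv x \<otimes> inv y \<in> D}"
proof -
  interpret D: normal D G by fact
  have conj: "g \<otimes> d \<otimes> inv g \<in> D" if "g \<in> carrier G" "d \<in> D" for g d
    using that D.inv_op_closed2 by blast
  have conj': "inv g \<otimes> d \<otimes> g \<in> D" if "g \<in> carrier G" "d \<in> D" for g d
    using that D.inv_op_closed1 by blast
  have mult: "x \<otimes> x' \<in> ?Z" if x: "x \<in> ?Z" and x': "x' \<in> ?Z" for x x'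
  proof -
    have c: "x \<in> carrier G" "x' \<in> carrier G" using x x' by auto
    have "x \<otimes> x' \<otimes> y \<otimes> inv (x \<otimes> x') \<otimes> inv y \<in> D" if y: "y \<in> carrier G" for y
    proof -
      \<comment> \<open>The commutator identity [xx', y] = x [x', y] x^-1 [x, y].\<close>
      have "(x \<otimes> (x' \<otimes> y \<otimes> inv x' \<otimes> inv y) \<otimes> inv x) \<otimes> (x \<otimes> y \<otimes> inv x \<otimes> inv y) \<in> D"
        using x x' y c conj D.m_closed by simp
      moreover have "(x \<otimes> (x' \<otimes> y \<otimes> inv x' \<otimes> inv y) \<otimes> inv x) \<otimes> (x \<otimes> y \<otimes> inv x \<otimes> inv y)
        = x \<otimes> x' \<otimes> y \<otimes> inv (x \<otimes> x') \<otimes> inv y"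
        using c y by (simp add: m_assoc inv_mult_group inv_solve_left' flip: m_assoc[of "inv x" x] m_assoc[of "inv y" y])
      ultimately show ?thesis by simp
    qed
    then show ?thesis using c by simp
  qed
  have inv: "inv x \<in> ?Z" if x: "x \<in> ?Z" for x
  proof -
    have c: "x \<in> carrier G" using x by auto
    have "inv x \<otimes> y \<otimes> inv (inv x) \<otimes> inv y \<in> D" if y: "y \<in> carrier G" for y
    proof -
      have "inv x \<otimes> inv (x \<otimes> y \<otimes> inv x \<otimes> inv y) \<otimes> x \<in> D"
        using x y c conj' D.m_inv_closed by simp
      moreover have "inv x \<otimes> inv (x \<otimes> y \<otimes> inv x \<otimes> inv y) \<otimes> x = inv x \<otimes> y \<otimes> inv (inv x) \<otimes> inv y"
        using c y by (simp add: m_assoc inv_mult_group)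
      ultimately show ?thesis by simp
    qed
    then show ?thesis using c by simp
  qed
  have cj: "g \<otimes> x \<otimes> inv g \<in> ?Z" if g: "g \<in> carrier G" and x: "x \<in> ?Z" for g x
  proof -
    have c: "x \<in> carrier G" using x by auto
    have "(g \<otimes> x \<otimes> inv g) \<otimes> y \<otimes> inv (g \<otimes> x \<otimes> inv g) \<otimes> inv y \<in> D" if y: "y \<in> carrier G" for y
    proof -
      \<comment> \<open>With this \<open>z\<close>, the commutator of the conjugated
        \<open>x\<close> with \<open>y\<close> is the conjugate by \<open>g\<close> of
        [x, z].\<close>
      define z where "z = inv g \<otimes> y \<otimes> g"
      have z: "z \<in> carrier G" "y = g \<otimes> z \<otimes> inv g"
        using g y by (auto simp: z_def m_assoc inv_solve_left' simp flip: m_assoc[of g "inv g"])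
      have "g \<otimes> (x \<otimes> z \<otimes> inv x \<otimes> inv z) \<otimes> inv g \<in> D" using x z g c conj by simp
      moreover have "g \<otimes> (x \<otimes> z \<otimes> inv x \<otimes> inv z) \<otimes> inv g
          = (g \<otimes> x \<otimes> inv g) \<otimes> y \<otimes> inv (g \<otimes> x \<otimes> inv g) \<otimes> inv y"
        unfolding z(2) using c g z(1)
        by (simp add: m_assoc inv_mult_group) (simp add: inv_solve_left' flip: m_assoc[of "inv g" g])
      ultimately show ?thesis by simp
    qed
    then show ?thesis using c g by simp
  qed
  have one: "\<one> \<in> ?Z" using D.one_closed by simp
  have "subgroup ?Z G" by (rule subgroup.intro) (use mult inv one in blast)+
  then show "?Z \<lhd> G" using cj by (rule normal_invI)
  show "D \<subseteq> ?Z"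
  proof
    fix d assume d: "d \<in> D"
    have "d \<otimes> y \<otimes> inv d \<otimes> inv y \<in> D" if y: "y \<in> carrier G" for y
    proof -
      have "d \<otimes> (y \<otimes> inv d \<otimes> inv y) \<in> D" using d y conj D.m_inv_closed D.m_closed by simp
      then show ?thesis using d y D.subset by (simp add: m_assoc subsetD)
    qed
    then show "d \<in> ?Z" using d D.subset by auto
  qed
qed

text \<open>The assumption says that every nontrivial quotient has a nontrivial centre. If ?Z is the
  preimage of the centre modulo \<open>D\<close> and a lower central term lies in ?Z, the next one
  lies in \<open>D\<close>; as ?Z is larger than \<open>D\<close>, induction downwards from
  \<open>G\<close> reaches \<open>D = {\<one>}\<close>.\<close>

lemma nilpotentI:
  assumes fin: "finite (carrier G)"
    and ex: "\<And>D. D \<lhd> G \<Longrightarrow> D \<noteq> carrier G \<Longrightarrow>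
      \<exists>x\<in>carrier G - D. \<forall>y\<in>carrier G. x \<otimes> y \<otimes> inv x \<otimes> inv y \<in> D"
  shows "nilpotent_group G"
proof -
  have "\<exists>n. lower_central G n \<subseteq> D" if "D \<lhd> G" for D
    using that
  proof (induction "order G - card D" arbitrary: D rule: less_induct)
    case less
    interpret D: normal D G by (rule less.prems)
    let ?Z = "{x \<in> carrier G. \<forall>y\<in>carrier G. x \<otimes> y \<otimes> inv x \<otimes> inv y \<in> D}"
    show ?case
    proof (cases "D = carrier G")
      case True
      then show ?thesis by (intro exI[of _ 0]) simp
    next
      case False
      note Z = central_mod_normal[OF less.prems]
      have "D \<noteq> ?Z" using ex[OF less.prems False] by blast
      then have "card D < card ?Z" using Z(2) fin by (intro psubset_card_mono) auto
      moreover have "card ?Z \<le> order G" unfolding order_def using fin by (intro card_mono) auto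
      ultimately have "order G - card ?Z < order G - card D" by simp
      then obtain n where n: "lower_central G n \<subseteq> ?Z" using less.hyps Z(1) by blast
      have "lower_central G (Suc n) \<subseteq> D"
        unfolding lower_central.simps
        by (rule generate_subgroup_incl[OF _ D.subgroup_axioms]) (use n in blast)
      then show ?thesis by blast
    qed
  qed
  then obtain n where n: "lower_central G n \<subseteq> {\<one>}" using one_is_normal by blast
  moreover have "\<one> \<in> lower_central G n" by (cases n) (auto intro: generate.one)
  ultimately show ?thesis unfolding nilpotent_group_def using is_group by blast
qed

text \<open>The quotient is a nontrivial p-group, and a nontrivial element of its centre is lifted
  to \<open>G\<close>. This supplies the assumption of \<open>nilpotentI\<close>.\<close>

lemma ex_central_mod_of_prime_power_index:
  assumes D: "D \<lhd> G" and p: "Factorial_Ring.prime (p::nat)" "card (rcosets D) = p ^ k" and ne: "D \<noteq> carrier G"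
  shows "\<exists>x\<in>carrier G - D. \<forall>y\<in>carrier G. x \<otimes> y \<otimes> inv x \<otimes> inv y \<in> D"
proof -
  interpret D: normal D G by fact
  interpret Q: group "G Mod D" by (rule D.factorgroup_is_group)
  have o: "order (G Mod D) = p ^ k" using p by (simp add: order_def FactGroup_def)
  have "k > 0"
  proof (rule ccontr)
    assume "\<not> k > 0"
    then have "card (rcosets D) = 1" using p by simp
    then have "rcosets D = {D}" using D.subgroup_in_rcosets[OF is_group] by (metis card_1_singletonE singletonD)
    then show False using rcosets_part_G[OF D.subgroup_axioms] ne by simp
  qed
  then obtain C where C: "C \<in> carrier (G Mod D)" "C \<noteq> D"
    "\<And>E. E \<in> carrier (G Mod D) \<Longrightarrow> E <#> C = C <#> E"
    using Q.p_group_center_nontrivial[OF p(1) o] by auto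
  then obtain x where x: "x \<in> carrier G" "C = D #> x" by (auto simp: carrier_FactGroup)
  have "x \<notin> D" using C(2) x coset_join2 D.subgroup_axioms by blast
  moreover have "x \<otimes> y \<otimes> inv x \<otimes> inv y \<in> D" if y: "y \<in> carrier G" for y
  proof -
    have "(D #> y) <#> (D #> x) = (D #> x) <#> (D #> y)"
      using C(3)[of "D #> y"] y x by (auto simp: carrier_FactGroup)
    then have "D #> (x \<otimes> y) = D #> (y \<otimes> x)" using x y by (simp add: D.rcos_sum)
    then have "x \<otimes> y \<in> D #> (y \<otimes> x)" using rcos_self[of "x \<otimes> y" D] x y D.subgroup_axioms by simp
    then have "(x \<otimes> y) \<otimes> inv (y \<otimes> x) \<in> D" using D.rcos_module_imp[OF is_group] x y by simp
    then show ?thesis using x y by (simp add: inv_mult_group m_assoc)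
  qed
  ultimately show ?thesis using x by blast
qed

lemma card_rcosets_dvd:
  assumes "subgroup D G" "finite (carrier G)" shows "card (rcosets D) dvd order G"
  using lagrange[OF assms(1)] by (metis dvd_triv_left)

lemma p_group_nilpotent:
  assumes p: "Factorial_Ring.prime (p::nat)" "order G = p ^ n"
  shows "nilpotent_group G"
proof -
  have fin: "finite (carrier G)" using p by (metis order_gt_0_iff_finite prime_gt_0_nat zero_less_power)
  show ?thesis
  proof (rule nilpotentI[OF fin])
    fix D assume D: "D \<lhd> G" "D \<noteq> carrier G"
    have "card (rcosets D) dvd p ^ n" using card_rcosets_dvd[OF normal_imp_subgroup[OF D(1)] fin] p by simp
    then obtain k where "card (rcosets D) = p ^ k" using p(1) divides_primepow_nat by blast
    then show "\<exists>x\<in>carrier G - D. \<forall>y\<in>carrier G. x \<otimes> y \<otimes> inv x \<otimes> inv y \<in> D"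
      using ex_central_mod_of_prime_power_index[OF D(1) p(1) _ D(2)] by blast
  qed
qed

lemma comm_group_nilpotent:
  assumes "comm_group G" shows "nilpotent_group G"
proof -
  interpret comm_group G by fact
  have "x \<otimes> y \<otimes> inv x \<otimes> inv y = \<one>" if "x \<in> carrier G" "y \<in> carrier G" for x y
    using that by (simp add: m_comm[of x y] m_assoc)
  then have "(\<Union>x\<in>carrier G. \<Union>y\<in>carrier G. {x \<otimes> y \<otimes> inv x \<otimes> inv y}) = {\<one>}" by auto
  then have "lower_central G (Suc 0) = {\<one>}" by (simp add: generate_one)
  then show ?thesis unfolding nilpotent_group_def using is_group by blast
qed

text \<open>Here \<open>G\<close> is the direct product of \<open>P\<close> and \<open>Q\<close>. In
  the criterion \<open>nilpotentI\<close>, an element of \<open>Q\<close> outside \<open>D\<close>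
  is central in \<open>G\<close>; if there is none, \<open>G Mod D\<close> is a p-group.\<close>

lemma nilpotent_of_normal_sylow_and_prime:
  assumes fin: "finite (carrier G)" and P: "P \<lhd> G" "card P = p ^ n" "Factorial_Ring.prime (p::nat)"
    and Q: "Q \<lhd> G" "card Q = q" "Factorial_Ring.prime (q::nat)" "p \<noteq> q" and PQ: "P <#> Q = carrier G"
  shows "nilpotent_group G"
proof (rule nilpotentI[OF fin])
  fix D assume D: "D \<lhd> G" "D \<noteq> carrier G"
  have sP: "subgroup P G" and sQ: "subgroup Q G" and sD: "subgroup D G"
    using P Q D normal_imp_subgroup by blast+
  show "\<exists>x\<in>carrier G - D. \<forall>y\<in>carrier G. x \<otimes> y \<otimes> inv x \<otimes> inv y \<in> D"
  proof (cases "Q \<subseteq> D")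
    case False
    then obtain x where x: "x \<in> Q" "x \<notin> D" by blast
    have xc: "x \<in> carrier G" "x \<noteq> \<one>" using x subgroup.mem_carrier[OF sQ] subgroup.one_closed[OF sD] by auto
    have Int: "P \<inter> Q = {\<one>}"
      using coprime_card_imp_Int_trivial[OF sP sQ] P Q by (simp add: primes_coprime)
    \<comment> \<open>By normality of both subgroups the commutator lies in \<open>P\<close> and in
      \<open>Q\<close>.\<close>
    have cP: "x \<otimes> a \<otimes> inv x \<otimes> inv a = \<one>" if a: "a \<in> P" for a
    proof -
      have ac: "a \<in> carrier G" using a subgroup.mem_carrier[OF sP] by blast
      have "x \<otimes> a \<otimes> inv x \<in> P" using normal.inv_op_closed2[OF P(1) xc(1) a] .
      then have 1: "x \<otimes> a \<otimes> inv x \<otimes> inv a \<in> P" using a sP subgroup.m_closed subgroup.m_inv_closed by metis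
      have "a \<otimes> inv x \<otimes> inv a \<in> Q" using normal.inv_op_closed2[OF Q(1) ac] x sQ subgroup.m_inv_closed by metis
      then have "x \<otimes> (a \<otimes> inv x \<otimes> inv a) \<in> Q" using x sQ subgroup.m_closed by metis
      then have "x \<otimes> a \<otimes> inv x \<otimes> inv a \<in> Q" using xc ac by (simp add: m_assoc)
      then show ?thesis using 1 Int by blast
    qed
    have cQ: "x \<otimes> b = b \<otimes> x" if b: "b \<in> Q" for b
    proof -
      have "b \<in> generate G {x}"
        using subgroup_prime_card_generate(1)[OF fin sQ _ x(1) xc(2)] Q b by simp
      then obtain k :: int where k: "b = x [^] k" using generate_pow[OF xc(1)] by auto
      then show ?thesis using xc(1) by (metis int_pow_1 int_pow_mult add.commute)
    qed
    have "x \<otimes> y \<otimes> inv x \<otimes> inv y \<in> D" if y: "y \<in> carrier G" for y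
    proof -
      obtain a b where ab: "a \<in> P" "b \<in> Q" "y = a \<otimes> b" using y unfolding PQ[symmetric] set_mult_def by blast
      have c: "a \<in> carrier G" "b \<in> carrier G" using ab subgroup.mem_carrier[OF sP] subgroup.mem_carrier[OF sQ] by auto
      have "\<one> = (x \<otimes> a) \<otimes> inv (a \<otimes> x)" using cP[OF ab(1)] c xc(1) by (simp add: inv_mult_group m_assoc)
      then have xa: "x \<otimes> a = a \<otimes> x" using c(1) xc(1) by (simp add: inv_solve_right)
      have "x \<otimes> y = (x \<otimes> a) \<otimes> b" using ab(3) c xc(1) by (simp add: m_assoc)
      also have "\<dots> = a \<otimes> (x \<otimes> b)" unfolding xa using c xc(1) by (simp add: m_assoc)
      also have "\<dots> = y \<otimes> x" unfolding cQ[OF ab(2)] using ab(3) c xc(1) by (simp add: m_assoc)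
      finally have "x \<otimes> y = y \<otimes> x" .
      then have "x \<otimes> y \<otimes> inv x \<otimes> inv y = \<one>" using y xc(1) by (simp add: m_assoc)
      then show ?thesis using subgroup.one_closed[OF sD] by simp
    qed
    then show ?thesis using x xc by blast
  next
    case True
    \<comment> \<open>Since \<open>q\<close> divides the order of \<open>D\<close>, this bound
      leaves only a power of \<open>p\<close> for the index of \<open>D\<close>.\<close>
    have le: "order G dvd p ^ n * q"
    proof -
      have "card Q dvd card D" using card_subgroup_dvd[OF sQ sD True] .
      have cop: "coprime (card P) (card Q)" using P Q by (simp add: primes_coprime)
      have "card P * card Q dvd order G"
        using cop card_subgroup_dvd_order[OF sP] card_subgroup_dvd_order[OF sQ] by (simp add: divides_mult)
      moreover have "order G \<le> card P * card Q"
        unfolding order_def PQ[symmetric]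
        using card_set_mult_le[of P Q] fin subgroup.subset[OF sP] subgroup.subset[OF sQ] finite_subset by blast
      moreover have "order G > 0" using fin order_gt_0_iff_finite by simp
      ultimately have "order G = card P * card Q" by (meson dvd_imp_le le_antisym)
      then show ?thesis using P Q by simp
    qed
    have "card (rcosets D) * q dvd p ^ n * q"
      using le lagrange[OF sD] card_subgroup_dvd[OF sQ sD True] Q(2) by (metis dvd_trans mult_dvd_mono dvd_refl)
    then have "card (rcosets D) dvd p ^ n" using Q(3) by (simp add: prime_gt_0_nat)
    then obtain k where "card (rcosets D) = p ^ k" using P(3) divides_primepow_nat by blast
    then show ?thesis
      using ex_central_mod_of_prime_power_index[OF D(1) P(3) _ D(2)] by blast
  qed
qed

end

text \<open>An isomorphism maps each lower central term onto the corresponding one. This is needed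
  because membership in a class is tested on copies over \<open>nat\<close>.\<close>

lemma nilpotent_group_iso:
  assumes "nilpotent_group G" "group H" "G \<cong> H"
  shows "nilpotent_group H"
proof -
  obtain f where f: "f \<in> iso G H" using assms(3) by (auto simp: is_iso_def)
  have G: "group G" using assms(1) by (simp add: nilpotent_group_def)
  interpret f: group_hom G H f
    using f G assms(2) by (simp add: group_hom_def group_hom_axioms_def iso_def)
  have surj: "f ` carrier G = carrier H" using f by (simp add: iso_def bij_betw_def)
  have sub: "lower_central G n \<subseteq> carrier G" for n
  proof (induction n)
    case (Suc n)
    have "(\<Union>x\<in>lower_central G n. \<Union>y\<in>carrier G. {x \<otimes>\<^bsub>G\<^esub> y \<otimes>\<^bsub>G\<^esub> inv\<^bsub>G\<^esub> x \<otimes>\<^bsub>G\<^esub> inv\<^bsub>G\<^esub> y}) \<subseteq> carrier G"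
      using Suc by auto
    then show ?case using f.G.generate_incl by simp
  qed simp
  have "lower_central H n = f ` lower_central G n" for n
  proof (induction n)
    case (Suc n)
    let ?c = "\<lambda>x y. x \<otimes>\<^bsub>G\<^esub> y \<otimes>\<^bsub>G\<^esub> inv\<^bsub>G\<^esub> x \<otimes>\<^bsub>G\<^esub> inv\<^bsub>G\<^esub> y"
    let ?A = "\<Union>x\<in>lower_central G n. \<Union>y\<in>carrier G. {?c x y}"
    have A: "?A \<subseteq> carrier G" using sub[of n] by auto
    have "f (?c x y) = f x \<otimes>\<^bsub>H\<^esub> f y \<otimes>\<^bsub>H\<^esub> inv\<^bsub>H\<^esub> f x \<otimes>\<^bsub>H\<^esub> inv\<^bsub>H\<^esub> f y"
      if "x \<in> lower_central G n" "y \<in> carrier G" for x y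
      using that sub[of n] by auto
    then have "f ` ?A = (\<Union>x\<in>lower_central H n. \<Union>y\<in>carrier H.
        {x \<otimes>\<^bsub>H\<^esub> y \<otimes>\<^bsub>H\<^esub> inv\<^bsub>H\<^esub> x \<otimes>\<^bsub>H\<^esub> inv\<^bsub>H\<^esub> y})"
      unfolding Suc surj[symmetric] by (simp add: image_UN)
    then show ?case using f.generate_img[OF A] by simp
  qed (simp add: surj)
  then show ?thesis using assms(1,2) f.hom_one unfolding nilpotent_group_def by (metis image_empty image_insert)
qed

section \<open>Formations and saturation\<close>

lemma (in group) core_eq:
  assumes "A \<subseteq> carrier G"
  shows "core G A = {x \<in> carrier G. \<forall>b\<in>carrier G. b \<otimes> x \<otimes> inv b \<in> A}"
proof -
  have *: "x \<in> (inv b <# A) #> b \<longleftrightarrow> x \<in> carrier G \<and> b \<otimes> x \<otimes> inv b \<in> A" if b: "b \<in> carrier G" for x b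
  proof
    assume "x \<in> (inv b <# A) #> b"
    then obtain a where a: "a \<in> A" "x = inv b \<otimes> a \<otimes> b" by (auto simp: l_coset_def r_coset_def)
    then have ac: "a \<in> carrier G" using assms by blast
    then have "b \<otimes> x \<otimes> inv b = a" using a(2) b by (simp add: m_assoc) (simp flip: m_assoc)
    then show "x \<in> carrier G \<and> b \<otimes> x \<otimes> inv b \<in> A" using a ac b by simp
  next
    assume x: "x \<in> carrier G \<and> b \<otimes> x \<otimes> inv b \<in> A"
    then have "x = inv b \<otimes> (b \<otimes> x \<otimes> inv b) \<otimes> b" using b by (simp add: m_assoc) (simp flip: m_assoc)
    then show "x \<in> (inv b <# A) #> b" using x by (auto simp: l_coset_def r_coset_def)
  qed
  have "x \<in> core G A \<longleftrightarrow> x \<in> carrier G \<and> (\<forall>b\<in>carrier G. b \<otimes> x \<otimes> inv b \<in> A)" for x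
    using * one_closed unfolding core_def by (metis (no_types, lifting) INT_iff)
  then show ?thesis by blast
qed

lemma (in group) core_normal:
  assumes "subgroup A G" shows "core G A \<lhd> G" "core G A \<subseteq> A"
proof -
  have sub: "A \<subseteq> carrier G" using assms subgroup.subset by blast
  note eq = core_eq[OF sub]
  show "core G A \<subseteq> A"
  proof
    fix x assume "x \<in> core G A"
    then have "x \<in> carrier G" "\<one> \<otimes> x \<otimes> inv \<one> \<in> A" unfolding eq by blast+
    then show "x \<in> A" by simp
  qed
  have "subgroup (core G A) G"
  proof (rule subgroup.intro)
    show "core G A \<subseteq> carrier G" unfolding eq by blast
    show "\<one> \<in> core G A" unfolding eq using subgroup.one_closed[OF assms] by simp
    fix x assume x: "x \<in> core G A"
    have "b \<otimes> inv x \<otimes> inv b \<in> A" if b: "b \<in> carrier G" for b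
    proof -
      have "b \<otimes> x \<otimes> inv b \<in> A" using x b unfolding eq by blast
      then have "inv (b \<otimes> x \<otimes> inv b) \<in> A" by (rule subgroup.m_inv_closed[OF assms])
      then show ?thesis using x b unfolding eq by (simp add: inv_mult_group m_assoc)
    qed
    then show "inv x \<in> core G A" using x unfolding eq by blast
    fix y assume y: "y \<in> core G A"
    have "b \<otimes> (x \<otimes> y) \<otimes> inv b \<in> A" if b: "b \<in> carrier G" for b
    proof -
      have "(b \<otimes> x \<otimes> inv b) \<otimes> (b \<otimes> y \<otimes> inv b) \<in> A"
        by (rule subgroup.m_closed[OF assms]) (use x y b in \<open>auto simp: eq\<close>)
      moreover have "(b \<otimes> x \<otimes> inv b) \<otimes> (b \<otimes> y \<otimes> inv b) = b \<otimes> (x \<otimes> y) \<otimes> inv b"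
        using x y b unfolding eq by (simp add: m_assoc inv_solve_left')
      ultimately show ?thesis by simp
    qed
    then show "x \<otimes> y \<in> core G A" using x y unfolding eq by blast
  qed
  then show "core G A \<lhd> G"
  proof (rule normal_invI)
    fix g x assume g: "g \<in> carrier G" and x: "x \<in> core G A"
    have "b \<otimes> (g \<otimes> x \<otimes> inv g) \<otimes> inv b \<in> A" if b: "b \<in> carrier G" for b
    proof -
      have "(b \<otimes> g) \<otimes> x \<otimes> inv (b \<otimes> g) \<in> A" using x m_closed[OF b g] unfolding eq by blast
      then show ?thesis using x g b unfolding eq by (simp add: inv_mult_group m_assoc)
    qed
    then show "g \<otimes> x \<otimes> inv g \<in> core G A" using x g unfolding eq by blast
  qed
qed

lemma (in group) core_of_normal:
  assumes "A \<lhd> G" shows "core G A = A"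
proof
  interpret normal A G by fact
  show "core G A \<subseteq> A" by (rule core_normal(2)[OF subgroup_axioms])
  show "A \<subseteq> core G A" unfolding core_eq[OF subset] using inv_op_closed2 subset by blast
qed

text \<open>Conjugates of maximal subgroups are maximal, so an element of all maximal subgroups lies
  in all their conjugates and hence in their cores.\<close>

lemma (in group) frattini_eq_Int_core:
  "frattini G = carrier G \<inter> (\<Inter>M\<in>{M. maximal_subgroup M G}. core G M)"
proof
  show "carrier G \<inter> (\<Inter>M\<in>{M. maximal_subgroup M G}. core G M) \<subseteq> frattini G"
    unfolding frattini_def using core_normal(2)[OF maximal_subgroup_imp_subgroup] by blast
  show "frattini G \<subseteq> carrier G \<inter> (\<Inter>M\<in>{M. maximal_subgroup M G}. core G M)"
  proof
    fix x assume x: "x \<in> frattini G"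
    then have xc: "x \<in> carrier G" and xm: "\<And>M. maximal_subgroup M G \<Longrightarrow> x \<in> M" by (auto simp: frattini_def)
    have "x \<in> core G M" if M: "maximal_subgroup M G" for M
    proof -
      have sub: "M \<subseteq> carrier G" using subgroup.subset[OF maximal_subgroup_imp_subgroup[OF M]] .
      have "b \<otimes> x \<otimes> inv b \<in> M" if b: "b \<in> carrier G" for b
      proof -
        have "x \<in> (\<lambda>h. inv b \<otimes> h \<otimes> inv (inv b)) ` M"
          using xm maximal_subgroup_iso_image[OF conj_iso[of "inv b"] is_group M] b by simp
        then obtain m where m: "m \<in> M" "x = inv b \<otimes> m \<otimes> b" using b by auto
        then have "m \<in> carrier G" using sub by blast
        then have "b \<otimes> x \<otimes> inv b = m" using m(2) b by (simp add: m_assoc) (simp flip: m_assoc)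
        then show ?thesis using m by simp
      qed
      then show ?thesis unfolding core_eq[OF sub] using xc by blast
    qed
    then show "x \<in> carrier G \<inter> (\<Inter>M\<in>{M. maximal_subgroup M G}. core G M)" using xc by blast
  qed
qed

lemma (in group) frattini_normal: "frattini G \<lhd> G"
\<comment> \<open>Without maximal subgroups the intersection with the carrier makes the Frattini
  subgroup all of \<open>G\<close>; otherwise it is an intersection of normal cores.\<close>
proof (cases "{M. maximal_subgroup M G} = {}")
  case True
  then show ?thesis using normal_self unfolding frattini_def by simp
next
  case False
  let ?S = "core G ` {M. maximal_subgroup M G}"
  have n: "N \<lhd> G" if "N \<in> ?S" for N using that core_normal(1)[OF maximal_subgroup_imp_subgroup] by blast
  have eq: "frattini G = \<Inter>?S"
    unfolding frattini_eq_Int_core using False n subgroup.subset[OF normal_imp_subgroup] by blast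
  have "subgroup (\<Inter>?S) G"
    by (rule subgroups_Inter) (use normal_imp_subgroup[OF n] False in blast)+
  then show ?thesis unfolding eq
  proof (rule normal_invI)
    fix x h assume *: "x \<in> carrier G" "h \<in> \<Inter>?S"
    show "x \<otimes> h \<otimes> inv x \<in> \<Inter>?S"
    proof (rule InterI)
      fix N assume "N \<in> ?S"
      then show "x \<otimes> h \<otimes> inv x \<in> N" using * normal.inv_op_closed2[OF n] by blast
    qed
  qed
qed

section \<open>Quotients that belong to a formation\<close>

lemma in_class_iso:
  assumes "in_class F H" "G \<cong> H" shows "in_class F G"
  using assms iso_trans unfolding in_class_def by blast

text \<open>Working with epimorphisms onto members of the class avoids isomorphisms between quotients.\<close>

lemma (in group) in_class_FactGroup_iff:
  assumes F: "formation F" and N: "N \<lhd> G"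
  shows "in_class F (G Mod N) \<longleftrightarrow>
    (\<exists>A\<in>F. \<exists>h\<in>hom G A. h ` carrier G = carrier A \<and> kernel G A h = N)"
proof
  interpret N: normal N G by fact
  interpret Q: group "G Mod N" by (rule N.factorgroup_is_group)
  assume "in_class F (G Mod N)"
  then obtain A f where A: "A \<in> F" "f \<in> iso (G Mod N) A" by (auto simp: in_class_def is_iso_def)
  interpret A: group A using A F by (auto simp: formation_def)
  interpret f: group_hom "G Mod N" A f
    using A by (simp add: group_hom_def group_hom_axioms_def iso_def Q.is_group A.is_group)
  let ?h = "f \<circ> (\<lambda>a. N #> a)"
  have bij: "bij_betw f (carrier (G Mod N)) (carrier A)" using A by (simp add: iso_def)
  have "?h \<in> hom G A" using Group.hom_compose[OF N.r_coset_hom_Mod f.homh] .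
  moreover have "?h ` carrier G = carrier A"
    using bij by (simp add: image_image bij_betw_def carrier_FactGroup)
  moreover have "kernel G A ?h = N"
  proof -
    have "?h x = \<one>\<^bsub>A\<^esub> \<longleftrightarrow> x \<in> N" if x: "x \<in> carrier G" for x
    proof -
      have c: "N #> x \<in> carrier (G Mod N)" "N \<in> carrier (G Mod N)"
        using x Q.one_closed by (auto simp: carrier_FactGroup)
      have "f N = \<one>\<^bsub>A\<^esub>" using f.hom_one by simp
      then have "f (N #> x) = \<one>\<^bsub>A\<^esub> \<longleftrightarrow> N #> x = N"
        using bij c by (metis bij_betw_def inj_on_eq_iff)
      also have "\<dots> \<longleftrightarrow> x \<in> N" using x coset_join2[OF x N.subgroup_axioms] rcos_self[OF x N.subgroup_axioms] by blast
      finally show ?thesis by simp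
    qed
    then show ?thesis using N.subset by (auto simp: kernel_def)
  qed
  ultimately show "\<exists>A\<in>F. \<exists>h\<in>hom G A. h ` carrier G = carrier A \<and> kernel G A h = N" using A by blast
next
  assume "\<exists>A\<in>F. \<exists>h\<in>hom G A. h ` carrier G = carrier A \<and> kernel G A h = N"
  then obtain A h where A: "A \<in> F" "h \<in> hom G A" "h ` carrier G = carrier A" "kernel G A h = N" by blast
  interpret h: group_hom G A h
    using A F by (auto simp: group_hom_def group_hom_axioms_def is_group formation_def)
  show "in_class F (G Mod N)" using h.FactGroup_iso[OF A(3)] A unfolding in_class_def by blast
qed

text \<open>The quotient by \<open>N \<inter> K\<close> is a subdirect product of the other two: it
  is the image of \<open>G\<close> under the pair of epimorphisms \<open>h\<close> and
  \<open>k\<close>.\<close>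

lemma (in group) in_class_FactGroup_Int:
  assumes F: "formation F" and N: "N \<lhd> G" and K: "K \<lhd> G"
    and "in_class F (G Mod N)" "in_class F (G Mod K)"
  shows "in_class F (G Mod (N \<inter> K))"
proof -
  obtain A h where A: "A \<in> F" "h \<in> hom G A" "h ` carrier G = carrier A" "kernel G A h = N"
    using assms(4) in_class_FactGroup_iff[OF F N] by blast
  obtain B k where B: "B \<in> F" "k \<in> hom G B" "k ` carrier G = carrier B" "kernel G B k = K"
    using assms(5) in_class_FactGroup_iff[OF F K] by blast
  interpret A: group A using A F by (auto simp: formation_def)
  interpret B: group B using B F by (auto simp: formation_def)
  interpret AB: group "A \<times>\<times> B" by (rule DirProd_group[OF A.is_group B.is_group])
  let ?f = "\<lambda>x. (h x, k x)"
  interpret f: group_hom G "A \<times>\<times> B" ?f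
    using A(2) B(2) by (auto simp: group_hom_def group_hom_axioms_def is_group AB.is_group hom_def)
  let ?S = "?f ` carrier G"
  have S: "subgroup ?S (A \<times>\<times> B)" using f.subgroup_img_is_subgroup[OF subgroup_self] .
  have "fst ` ?S = carrier A" "snd ` ?S = carrier B" using A(3) B(3) by (auto simp: image_image)
  then have "in_class F ((A \<times>\<times> B)\<lparr>carrier := ?S\<rparr>)"
    using F S A(1) B(1) unfolding formation_def by blast
  \<comment> \<open>The subdirect product consists of pairs and so is not itself a member of
    \<open>F\<close>; \<open>C\<close> is its copy there.\<close>
  then obtain C g where C: "C \<in> F" "g \<in> iso ((A \<times>\<times> B)\<lparr>carrier := ?S\<rparr>) C"
    by (auto simp: in_class_def is_iso_def)
  interpret S: group "(A \<times>\<times> B)\<lparr>carrier := ?S\<rparr>" by (rule AB.subgroup_imp_group[OF S])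
  interpret C: group C using C F by (auto simp: formation_def)
  interpret g: group_hom "(A \<times>\<times> B)\<lparr>carrier := ?S\<rparr>" C g
    using C by (simp add: group_hom_def group_hom_axioms_def iso_def S.is_group C.is_group)
  have bij: "bij_betw g ?S (carrier C)" using C by (simp add: iso_def)
  have "?f \<in> hom G ((A \<times>\<times> B)\<lparr>carrier := ?S\<rparr>)" using f.homh by (auto simp: hom_def)
  then have "g \<circ> ?f \<in> hom G C" using Group.hom_compose g.homh by blast
  moreover have "(g \<circ> ?f) ` carrier G = carrier C" using bij by (simp add: image_image bij_betw_def)
  moreover have "kernel G C (g \<circ> ?f) = N \<inter> K"
  proof -
    have "g (?f x) = \<one>\<^bsub>C\<^esub> \<longleftrightarrow> h x = \<one>\<^bsub>A\<^esub> \<and> k x = \<one>\<^bsub>B\<^esub>" if x: "x \<in> carrier G" for x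
    proof -
      have "g (\<one>\<^bsub>A\<^esub>, \<one>\<^bsub>B\<^esub>) = \<one>\<^bsub>C\<^esub>" using g.hom_one by simp
      moreover have 1: "(\<one>\<^bsub>A\<^esub>, \<one>\<^bsub>B\<^esub>) \<in> ?S" using subgroup.one_closed[OF S] by simp
      moreover have "?f x \<in> ?S" using x by blast
      ultimately have "g (?f x) = \<one>\<^bsub>C\<^esub> \<longleftrightarrow> ?f x = (\<one>\<^bsub>A\<^esub>, \<one>\<^bsub>B\<^esub>)"
        using inj_on_eq_iff[OF bij_betw_imp_inj_on[OF bij], of "?f x" "(\<one>\<^bsub>A\<^esub>, \<one>\<^bsub>B\<^esub>)"] by simp
      then show ?thesis by simp
    qed
    then show ?thesis using A(4) B(4) by (auto simp: kernel_def)
  qed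
  moreover have "N \<inter> K \<lhd> G" using normal_subgroup_intersect[OF N K] .
  ultimately show ?thesis using in_class_FactGroup_iff[OF F] C(1) by blast
qed

text \<open>The hypothesis on \<open>F\<close> speaks of groups over \<open>nat\<close> only, so
  nilpotency is carried over to a copy.\<close>

lemma (in group) in_class_nilpotent:
  assumes "contains_nilpotent_groups F" "finite (carrier G)" "nilpotent_group G"
  shows "in_class F G"
proof -
  obtain H :: "nat monoid" where H: "group H" "G \<cong> H" using ex_nat_copy[OF assms(2)] by blast
  have "nilpotent_group H" using nilpotent_group_iso[OF assms(3) H] .
  moreover have "finite (carrier H)" using H(2) assms(2) unfolding is_iso_def iso_def
    by (auto dest: bij_betw_finite)
  ultimately show ?thesis using assms(1) H(2) unfolding contains_nilpotent_groups_def in_class_def by blast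
qed

lemma (in group) in_class_comm_FactGroup:
  assumes "contains_nilpotent_groups F" "finite (carrier G)" "N \<lhd> G" "comm_group (G Mod N)"
  shows "in_class F (G Mod N)"
proof -
  interpret Q: comm_group "G Mod N" by fact
  have "finite (carrier (G Mod N))" using assms(2) by (simp add: carrier_FactGroup)
  then show ?thesis using Q.in_class_nilpotent assms(1) Q.comm_group_nilpotent Q.comm_group_axioms by blast
qed

text \<open>The Frattini subgroup is a finite intersection of cores, and each core that is added
  gives another subdirect product. The empty intersection is \<open>G\<close>, whose trivial
  quotient is abelian.\<close>

lemma (in group) in_class_FactGroup_frattini:
  assumes F: "formation F" "contains_nilpotent_groups F" and fin: "finite (carrier G)"
    and max: "\<And>M. maximal_subgroup M G \<Longrightarrow> in_class F (G Mod core G M)"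
  shows "in_class F (G Mod frattini G)"
proof -
  have *: "carrier G \<inter> (\<Inter>M\<in>S. core G M) \<lhd> G \<and> in_class F (G Mod (carrier G \<inter> (\<Inter>M\<in>S. core G M)))"
    if "finite S" "\<And>M. M \<in> S \<Longrightarrow> maximal_subgroup M G" for S
    using that
  proof (induction S)
    case empty
    have "carrier (G Mod carrier G) = {carrier G}"
      using coset_join2 subgroup_self by (auto simp: carrier_FactGroup)
    then have "comm_group (G Mod carrier G)"
      using group.group_comm_groupI[OF normal.factorgroup_is_group[OF normal_self]] by auto
    then show ?case using in_class_comm_FactGroup[OF F(2) fin normal_self] normal_self by simp
  next
    case (insert M S)
    have M: "maximal_subgroup M G" using insert by blast
    let ?N = "carrier G \<inter> (\<Inter>M\<in>S. core G M)"
    have N: "?N \<lhd> G" "in_class F (G Mod ?N)" using insert by blast+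
    have M': "core G M \<lhd> G" using core_normal(1)[OF maximal_subgroup_imp_subgroup[OF M]] .
    have eq: "carrier G \<inter> (\<Inter>M\<in>insert M S. core G M) = ?N \<inter> core G M" by auto
    show ?case unfolding eq
      using in_class_FactGroup_Int[OF F(1) N(1) M' N(2) max[OF M]] normal_subgroup_intersect[OF N(1) M'] by blast
  qed
  have "finite {M. maximal_subgroup M G}"
    by (rule finite_subset[of _ "Pow (carrier G)"])
      (use fin subgroup.subset[OF maximal_subgroup_imp_subgroup] in auto)
  then show ?thesis unfolding frattini_eq_Int_core using *[of "{M. maximal_subgroup M G}"] by blast
qed

lemma frattini_iso:
  assumes g: "g \<in> iso H G" and H: "group H" and G: "group G" and y: "y \<in> carrier H"
  shows "y \<in> frattini H \<longleftrightarrow> g y \<in> frattini G"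
proof -
  interpret H: group H by fact
  interpret G: group G by fact
  have bij: "bij_betw g (carrier H) (carrier G)" using g by (simp add: iso_def)
  have gy: "g y \<in> carrier G" using bij y bij_betwE by blast
  have f: "inv_into (carrier H) g \<in> iso G H" using H.iso_set_sym[OF g] .
  have inv: "inv_into (carrier H) g (g y) = y" using bij y by (simp add: bij_betw_inv_into_left)
  show ?thesis
  proof
    assume yF: "y \<in> frattini H"
    have "g y \<in> M" if M: "maximal_subgroup M G" for M
    proof -
      have "y \<in> inv_into (carrier H) g ` M"
        using G.maximal_subgroup_iso_image[OF f H M] yF by (auto simp: frattini_def)
      then obtain m where m: "m \<in> M" "y = inv_into (carrier H) g m" by blast
      have "m \<in> carrier G" using m subgroup.subset[OF G.maximal_subgroup_imp_subgroup[OF M]] by blast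
      then show ?thesis using m bij by (simp add: bij_betw_inv_into_right)
    qed
    then show "g y \<in> frattini G" using gy by (simp add: frattini_def)
  next
    assume gF: "g y \<in> frattini G"
    have "y \<in> M" if M: "maximal_subgroup M H" for M
    proof -
      have "g y \<in> g ` M" using H.maximal_subgroup_iso_image[OF g G M] gF by (auto simp: frattini_def)
      moreover have "M \<subseteq> carrier H" using subgroup.subset[OF H.maximal_subgroup_imp_subgroup[OF M]] .
      ultimately show ?thesis using bij y by (metis bij_betw_def inj_on_image_mem_iff)
    qed
    then show "y \<in> frattini H" using y by (simp add: frattini_def)
  qed
qed

text \<open>Saturation is stated over \<open>nat\<close>, so a copy \<open>H\<close> is used:
  composed with \<open>g\<close>, the epimorphism with kernel \<open>frattini G\<close> becomes one
  on \<open>H\<close> with kernel \<open>frattini H\<close>.\<close>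

lemma (in group) in_class_of_FactGroup_frattini:
  assumes F: "formation F" "saturated F" and fin: "finite (carrier G)" and fr: "in_class F (G Mod frattini G)"
  shows "in_class F G"
proof -
  obtain H :: "nat monoid" where H: "group H" "G \<cong> H" using ex_nat_copy[OF fin] by blast
  have finH: "finite (carrier H)" using H(2) fin unfolding is_iso_def iso_def by (auto dest: bij_betw_finite)
  interpret H: group H by fact
  obtain g where g: "g \<in> iso H G" using H(2) iso_sym unfolding is_iso_def by blast
  obtain A h where A: "A \<in> F" "h \<in> hom G A" "h ` carrier G = carrier A" "kernel G A h = frattini G"
    using fr in_class_FactGroup_iff[OF F(1) frattini_normal] by blast
  have bij: "bij_betw g (carrier H) (carrier G)" using g by (simp add: iso_def)
  have "h \<circ> g \<in> hom H A" using Group.hom_compose A(2) g by (auto simp: iso_def)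
  moreover have "(h \<circ> g) ` carrier H = carrier A" using bij A(3) unfolding bij_betw_def by (metis image_comp)
  moreover have "kernel H A (h \<circ> g) = frattini H"
  proof -
    have "h (g y) = \<one>\<^bsub>A\<^esub> \<longleftrightarrow> y \<in> frattini H" if y: "y \<in> carrier H" for y
    proof -
      have "g y \<in> carrier G" using bij y bij_betwE by blast
      then have "h (g y) = \<one>\<^bsub>A\<^esub> \<longleftrightarrow> g y \<in> frattini G" using A(4) by (auto simp: kernel_def)
      then show ?thesis using frattini_iso[OF g H(1) is_group y] by simp
    qed
    moreover have "frattini H \<subseteq> carrier H" by (auto simp: frattini_def)
    ultimately show ?thesis by (auto simp: kernel_def)
  qed
  ultimately have "in_class F (H Mod frattini H)"
    using H.in_class_FactGroup_iff[OF F(1) H.frattini_normal] A(1) by blast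
  then have "H \<in> F" using F(2) H(1) finH unfolding saturated_def by blast
  then show ?thesis using H(2) unfolding in_class_def by blast
qed

section \<open>Chains witnessing F-subnormality\<close>

lemma F_subnormal_imp_maximal:
  assumes "F_subnormal F L G" "L \<noteq> carrier G"
  shows "\<exists>M. maximal_subgroup M G \<and> L \<subseteq> M \<and> in_class F (G Mod core G M)"
proof -
  obtain n and K :: "nat \<Rightarrow> 'a set" where K: "K 0 = L" "K n = carrier G"
    "\<And>i. i < n \<Longrightarrow> maximal_subgroup (K i) (G\<lparr>carrier := K (Suc i)\<rparr>)"
    "\<And>i. i < n \<Longrightarrow> in_class F (G\<lparr>carrier := K (Suc i)\<rparr> Mod core (G\<lparr>carrier := K (Suc i)\<rparr>) (K i))"
    using assms(1) unfolding F_subnormal_def by blast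
  \<comment> \<open>The chain has a last step, and its lower term \<open>K m\<close> is the maximal
    subgroup wanted.\<close>
  have "n \<noteq> 0" using K(1,2) assms(2) by (cases n) auto
  then obtain m where m: "n = Suc m" by (cases n) auto
  have "L \<subseteq> K i" if "i \<le> n" for i
    using that
  proof (induction i)
    case (Suc i)
    then have "K i \<subseteq> K (Suc i)" using K(3)[of i] subgroup.subset unfolding maximal_subgroup_def by fastforce
    then show ?case using Suc by simp
  qed (simp add: K(1))
  then have "L \<subseteq> K m" using m by simp
  moreover have "G\<lparr>carrier := K (Suc m)\<rparr> = G" using K(2) m by simp
  ultimately show ?thesis using K(3)[of m] K(4)[of m] m by auto
qed

lemma F_subnormal_refl: "F_subnormal F (carrier G) G"
  unfolding F_subnormal_def by (rule exI[of _ 0]) auto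

lemma F_subnormal_step:
  assumes "F_subnormal F L G" "maximal_subgroup M (G\<lparr>carrier := L\<rparr>)"
    "in_class F (G\<lparr>carrier := L\<rparr> Mod core (G\<lparr>carrier := L\<rparr>) M)"
  shows "F_subnormal F M G"
proof -
  obtain n and K :: "nat \<Rightarrow> 'a set" where K: "K 0 = L" "K n = carrier G"
    "\<And>i. i < n \<Longrightarrow> maximal_subgroup (K i) (G\<lparr>carrier := K (Suc i)\<rparr>) \<and>
      in_class F (G\<lparr>carrier := K (Suc i)\<rparr> Mod core (G\<lparr>carrier := K (Suc i)\<rparr>) (K i))"
    using assms(1) unfolding F_subnormal_def by blast
  show ?thesis unfolding F_subnormal_def
    \<comment> \<open>\<open>case_nat M K\<close> puts \<open>M\<close> in front of the chain and
      shifts the rest by one.\<close>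
    by (rule exI[of _ "Suc n"], rule exI[of _ "case_nat M K"])
      (use K assms(2,3) in \<open>auto simp: less_Suc_eq_0_disj\<close>)
qed

text \<open>The top step, from \<open>P\<close> to \<open>G\<close>, is given. Below
  \<open>P\<close> everything is abelian, so every quotient met is nilpotent and lies in the class;
  \<open>L\<close> is reached by induction on how much smaller than \<open>G\<close> it is.\<close>

lemma (in group) F_subnormal_of_normal_comm_maximal:
  assumes F: "contains_nilpotent_groups F" and fin: "finite (carrier G)"
    and P: "P \<lhd> G" "maximal_subgroup P G" "in_class F (G Mod P)" "comm_group (G\<lparr>carrier := P\<rparr>)"
    and L: "subgroup L G" "L \<subseteq> P"
  shows "F_subnormal F L G"
  using L
proof (induction "order G - card L" arbitrary: L rule: less_induct)
  case less
  have sP: "subgroup P G" using normal_imp_subgroup[OF P(1)] .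
  show ?case
  proof (cases "L = P")
    case True
    show ?thesis unfolding True
      by (rule F_subnormal_step[OF F_subnormal_refl]) (use P core_of_normal in simp_all)
  next
    case False
    \<comment> \<open>A minimal member \<open>K\<close> has \<open>L\<close> as a maximal subgroup
      and, being larger than \<open>L\<close>, is covered by the induction hypothesis.\<close>
    let ?A = "{K. subgroup K G \<and> L \<subset> K \<and> K \<subseteq> P}"
    have "finite ?A"
      by (rule finite_subset[of _ "Pow (carrier G)"]) (use fin subgroup.subset in auto)
    moreover have "P \<in> ?A" using False less.prems sP by blast
    ultimately obtain K where K: "K \<in> ?A" "\<And>K'. K' \<in> ?A \<Longrightarrow> K' \<subseteq> K \<Longrightarrow> K = K'"
      using finite_has_minimal[of ?A] by (metis (no_types, lifting) empty_iff)
    then have sK: "subgroup K G" "L \<subset> K" "K \<subseteq> P" by auto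
    interpret GK: group "G\<lparr>carrier := K\<rparr>" by (rule subgroup_imp_group[OF sK(1)])
    have LK: "subgroup L (G\<lparr>carrier := K\<rparr>)" using subgroup_incl[OF less.prems(1) sK(1)] sK(2) by blast
    have "finite K" using finite_subset[OF subgroup.subset[OF sK(1)] fin] .
    then have "card L < card K" using sK(2) psubset_card_mono by blast
    moreover have "card K \<le> order G" unfolding order_def using fin subgroup.subset[OF sK(1)] card_mono by blast
    ultimately have "order G - card K < order G - card L" by simp
    then have sub: "F_subnormal F K G" using less.hyps sK by blast
    have max: "maximal_subgroup L (G\<lparr>carrier := K\<rparr>)" unfolding maximal_subgroup_def
    proof (intro conjI allI impI)
      show "L \<noteq> carrier (G\<lparr>carrier := K\<rparr>)" using sK by simp
      fix M assume M: "subgroup M (G\<lparr>carrier := K\<rparr>) \<and> L \<subseteq> M"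
      then have "subgroup M G" "M \<subseteq> K" using incl_subgroup[OF sK(1)] subgroup.subset[of M "G\<lparr>carrier := K\<rparr>"] by auto
      then show "M = L \<or> M = carrier (G\<lparr>carrier := K\<rparr>)" using K(2)[of M] M sK(3) by auto
    qed (rule LK)
    have "comm_group (G\<lparr>carrier := K\<rparr>)"
      by (rule GK.group_comm_groupI) (use comm_groupE(4)[OF P(4)] sK(3) in auto)
    then have "comm_group (G\<lparr>carrier := K\<rparr> Mod core (G\<lparr>carrier := K\<rparr>) L)"
      using comm_group.abelian_FactGroup normal_imp_subgroup[OF GK.core_normal(1)[OF LK]] by blast
    then have "in_class F (G\<lparr>carrier := K\<rparr> Mod core (G\<lparr>carrier := K\<rparr>) L)"
      using GK.in_class_comm_FactGroup[OF F _ GK.core_normal(1)[OF LK]] \<open>finite K\<close> by simp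
    then show ?thesis using F_subnormal_step[OF sub max] by blast
  qed
qed

section \<open>Groups whose proper subgroups have prime power order\<close>

lemma ex_other_prime_factor:
  fixes n p :: nat
  assumes "n > 0" "Factorial_Ring.prime p" "\<And>k. n \<noteq> p ^ k"
  shows "\<exists>q. Factorial_Ring.prime q \<and> q dvd n \<and> q \<noteq> p"
proof -
  have "n \<noteq> 0" "\<not> is_unit p" using assms(1,2) by auto
  then obtain m where m: "n = p ^ multiplicity p n * m" "\<not> p dvd m"
    using multiplicity_decompose' by blast
  then have "m \<noteq> 1" using assms(3) by (metis mult.right_neutral)
  then obtain q where "Factorial_Ring.prime q" "q dvd m" using prime_factor_nat by blast
  then show ?thesis using m by (metis dvd_mult)
qed

lemma prime_dvd_prime_power:
  fixes p q :: nat
  assumes "Factorial_Ring.prime p" "Factorial_Ring.prime q" "p dvd q ^ n" shows "p = q"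
  using assms by (metis prime_dvd_power primes_dvd_imp_eq)

context group begin

lemma comm_group_of_generate_singleton:
  assumes x: "x \<in> carrier G" "generate G {x} = carrier G"
  shows "comm_group G"
proof (rule group_comm_groupI)
  fix y z assume "y \<in> carrier G" "z \<in> carrier G"
  then obtain i j :: int where "y = x [^] i" "z = x [^] j"
    unfolding x(2)[symmetric] generate_pow[OF x(1)] by blast
  then show "y \<otimes> z = z \<otimes> y" using x(1) by (simp add: int_pow_mult[symmetric] add.commute)
qed

lemma comm_group_of_prime_order:
  assumes "Factorial_Ring.prime (order G)" shows "comm_group G"
proof -
  have fin: "finite (carrier G)" using assms by (metis order_gt_0_iff_finite prime_gt_0_nat)
  have "carrier G \<noteq> {\<one>}" using assms by (auto simp: order_def)
  then obtain x where x: "x \<in> carrier G" "x \<noteq> \<one>" by blast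
  have "generate G {x} = carrier G"
    using subgroup_prime_card_generate(1)[OF fin subgroup_self _ x] assms by (simp add: order_def)
  then show ?thesis using comm_group_of_generate_singleton x by blast
qed

lemma card_subgroup_eq_1_iff:
  assumes "subgroup H G" shows "card H = 1 \<longleftrightarrow> H = {\<one>}"
  using subgroup.one_closed[OF assms] by (auto simp: card_1_singleton_iff)

text \<open>The index of \<open>D\<close> in the p-group \<open>K\<close> is a nontrivial power of
  \<open>p\<close>, so the coset count applies inside \<open>K\<close>.\<close>

lemma p_subgroup_normalizer_grows:
  assumes fin: "finite (carrier G)" and K: "subgroup K G" "card K = p ^ c" "Factorial_Ring.prime (p::nat)"
    and D: "subgroup D G" "D \<subset> K"
  shows "\<exists>x\<in>K - D. x \<in> normalizer G D"
proof -
  interpret GK: group "G\<lparr>carrier := K\<rparr>" by (rule subgroup_imp_group[OF K(1)])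
  have finK: "finite K" using finite_subset[OF subgroup.subset[OF K(1)] fin] .
  have DK: "subgroup D (G\<lparr>carrier := K\<rparr>)" using subgroup_incl[OF D(1) K(1)] D(2) by blast
  let ?i = "card (rcosets\<^bsub>G\<lparr>carrier := K\<rparr>\<^esub> D)"
  have l: "?i * card D = p ^ c" using GK.lagrange[OF DK] K(2) by (simp add: order_def)
  then have "?i dvd p ^ c" "card D dvd p ^ c" by (metis dvd_triv_left, metis dvd_triv_right)
  then obtain i j where ij: "?i = p ^ i" "card D = p ^ j" using divides_primepow_nat[OF K(3)] by blast
  have "card D < p ^ c" using psubset_card_mono[OF finK D(2)] K(2) by simp
  then have "i \<noteq> 0" using l ij by (cases i) auto
  then have "p dvd ?i" using ij by simp
  then obtain x where x: "x \<in> K - D" "\<forall>h\<in>D. x \<otimes>\<^bsub>G\<lparr>carrier := K\<rparr>\<^esub> h \<otimes>\<^bsub>G\<lparr>carrier := K\<rparr>\<^esub> inv\<^bsub>G\<lparr>carrier := K\<rparr>\<^esub> x \<in> D"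
    using GK.normalizing_element_outside_p_subgroup[OF DK _ K(3) ij(2)] finK by auto
  have "x \<in> normalizer G D"
    using x mem_normalizer_iff[OF fin D(1)] subgroup.mem_carrier[OF K(1)] m_inv_consistent[OF K(1)] by auto
  then show ?thesis using x by blast
qed

lemma prime_power_subgroup_not_two_primes:
  assumes "proper_subgroups_prime_power G" "subgroup H G"
    and "Factorial_Ring.prime (p::nat)" "Factorial_Ring.prime (q::nat)" "p \<noteq> q" "p dvd card H" "q dvd card H"
  shows "H = carrier G"
proof (rule ccontr)
  assume "H \<noteq> carrier G"
  then obtain r n where "Factorial_Ring.prime (r::nat)" "card H = r ^ n"
    using assms(1,2) unfolding proper_subgroups_prime_power_def by blast
  then show False using assms prime_dvd_prime_power by metis
qed

lemma order_eq_of_set_mult: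
  assumes fin: "finite (carrier G)" and H: "subgroup H G" and K: "subgroup K G" and cop: "coprime (card H) (card K)"
    and eq: "H <#> K = carrier G"
  shows "order G = card H * card K"
proof -
  have "card H * card K dvd order G"
    using divides_mult[OF card_subgroup_dvd_order[OF H] card_subgroup_dvd_order[OF K] cop] .
  moreover have "order G \<le> card H * card K"
    unfolding order_def eq[symmetric]
    by (rule card_set_mult_le) (use finite_subset[OF subgroup.subset fin] H K in auto)
  moreover have "order G > 0" using fin order_gt_0_iff_finite by simp
  ultimately show ?thesis by (meson dvd_imp_le le_antisym)
qed

lemma ex_normal_maximal_subgroup:
  assumes fin: "finite (carrier G)" and pp: "proper_subgroups_prime_power G" and nn: "\<not> nilpotent_group G"
  shows "\<exists>M. maximal_subgroup M G \<and> M \<lhd> G"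
proof (rule ccontr)
  assume "\<nexists>M. maximal_subgroup M G \<and> M \<lhd> G"
  then have sn: "normalizer G M = M" if "maximal_subgroup M G" for M
    using maximal_subgroup_self_normalizing[OF fin that] that by (auto simp: self_normalizing_def)
  have npo: "order G \<noteq> p ^ k" if "Factorial_Ring.prime p" for p k
    using p_group_nilpotent[OF that] nn by blast
  have pos: "order G > 0" using fin order_gt_0_iff_finite by simp
  have other: "\<exists>q. Factorial_Ring.prime q \<and> q dvd order G \<and> q \<noteq> p" if "Factorial_Ring.prime p" for p
    using ex_other_prime_factor[OF pos that npo[OF that]] .
  have maxc: "\<exists>p a. Factorial_Ring.prime (p::nat) \<and> card M = p ^ a" if "maximal_subgroup M G" for M
    using that pp unfolding maximal_subgroup_def proper_subgroups_prime_power_def by blast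
  \<comment> \<open>Otherwise take \<open>D\<close> maximal among the nontrivial intersections of
    two distinct maximal subgroups. Both of these turn out to be p-groups for the same
    \<open>p\<close>, and the normalizer of \<open>D\<close> grows in each.\<close>
  have triv: "A \<inter> B = {\<one>}" if AB: "maximal_subgroup A G" "maximal_subgroup B G" "A \<noteq> B" for A B
  proof (rule ccontr)
    assume ne: "A \<inter> B \<noteq> {\<one>}"
    let ?T = "{D. D \<noteq> {\<one>} \<and> (\<exists>A B. maximal_subgroup A G \<and> maximal_subgroup B G \<and> A \<noteq> B \<and> D = A \<inter> B)}"
    have "finite ?T"
      by (rule finite_subset[of _ "Pow (carrier G)"])
        (use fin subgroup.subset[OF maximal_subgroup_imp_subgroup] in auto)
    moreover have "A \<inter> B \<in> ?T" using AB ne by blast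
    ultimately obtain D where D: "D \<in> ?T" "\<And>E. E \<in> ?T \<Longrightarrow> D \<subseteq> E \<Longrightarrow> D = E"
      using finite_has_maximal[of ?T] by (metis (no_types, lifting) empty_iff)
    then obtain A B where AB: "maximal_subgroup A G" "maximal_subgroup B G" "A \<noteq> B" "D = A \<inter> B" "D \<noteq> {\<one>}"
      by blast
    have s: "subgroup A G" "subgroup B G" using AB maximal_subgroup_imp_subgroup by auto
    have sD: "subgroup D G" using subgroups_Inter_pair[OF s] AB(4) by simp
    have nc: "A \<noteq> carrier G" "B \<noteq> carrier G" using AB by (auto simp: maximal_subgroup_def)
    have DA: "D \<subset> A"
    proof -
      have "D \<noteq> A"
      proof
        assume "D = A"
        then have "A \<subseteq> B" using AB(4) by blast
        then show False using AB(1,3) s(2) nc unfolding maximal_subgroup_def by blast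
      qed
      then show ?thesis using AB(4) by blast
    qed
    have DB: "D \<subset> B"
    proof -
      have "D \<noteq> B"
      proof
        assume "D = B"
        then have "B \<subseteq> A" using AB(4) by blast
        then show False using AB(2,3) s(1) nc unfolding maximal_subgroup_def by blast
      qed
      then show ?thesis using AB(4) by blast
    qed
    obtain p a where pa: "Factorial_Ring.prime (p::nat)" "card A = p ^ a" using maxc AB(1) by blast
    obtain r b where rb: "Factorial_Ring.prime (r::nat)" "card B = r ^ b" using maxc AB(2) by blast
    have "card D \<noteq> 1" using card_subgroup_eq_1_iff[OF sD] AB(5) by simp
    moreover have "card D dvd p ^ a" using card_subgroup_dvd[OF sD s(1)] DA pa by auto
    then obtain i where i: "card D = p ^ i" using divides_primepow_nat[OF pa(1)] by blast
    ultimately have pD: "p dvd card D" by (cases i) auto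
    then have "p dvd r ^ b" using card_subgroup_dvd[OF sD s(2)] DB rb by (metis dvd_trans psubset_imp_subset)
    then have pr: "p = r" using prime_dvd_prime_power pa rb by blast
    obtain x where x: "x \<in> A - D" "x \<in> normalizer G D"
      using p_subgroup_normalizer_grows[OF fin s(1) pa(2,1) sD DA] by blast
    obtain y where y: "y \<in> B - D" "y \<in> normalizer G D"
      using p_subgroup_normalizer_grows[OF fin s(2) rb(2,1) sD DB] by blast
    \<comment> \<open>If \<open>D\<close> were normal, its product with a subgroup of another prime
      order \<open>q\<close> would have two primes in its order and so be \<open>G\<close>. Then
      \<open>D\<close> would have the full p-part of |G|, although it is properly contained in the
      p-group \<open>A\<close>.\<close>
    have "normalizer G D \<noteq> carrier G"
    proof
      assume "normalizer G D = carrier G"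
      then have Dn: "D \<lhd> G" using normal_iff_normalizer[OF fin sD] by simp
      obtain q where q: "Factorial_Ring.prime q" "q dvd order G" "q \<noteq> p" using other[OF pa(1)] by blast
      then obtain z where z: "z \<in> carrier G" "ord z = q"
        using cauchy[OF fin subgroup_self] by (auto simp: order_def)
      let ?Q = "generate G {z}"
      note Q = generate_singleton[OF z(1)]
      note E = set_mult_normal_subgroup[OF Dn Q(1)]
      have "p dvd card (D <#> ?Q)" using card_subgroup_dvd[OF sD E(1,2)] pD dvd_trans by blast
      moreover have "q dvd card (D <#> ?Q)" using card_subgroup_dvd[OF Q(1) E(1,3)] Q(3) z(2) by simp
      ultimately have eq: "D <#> ?Q = carrier G"
        using prime_power_subgroup_not_two_primes[OF pp E(1) pa(1) q(1)] q(3) by blast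
      have cop: "coprime (card D) (card ?Q)" using i Q(3) z(2) pa(1) q by (simp add: primes_coprime)
      have o: "order G = card D * q" using order_eq_of_set_mult[OF fin sD Q(1) cop eq] Q(3) z(2) by simp
      have "coprime (card A) q" using pa q by (simp add: primes_coprime)
      then have "card A * q dvd card D * q"
        using divides_mult[OF card_subgroup_dvd_order[OF s(1)] q(2)] o by simp
      then have "card A dvd card D" using prime_gt_0_nat[OF q(1)] by simp
      then have "card A \<le> card D" using i pa(1) by (intro dvd_imp_le) (simp_all add: prime_gt_0_nat)
      moreover have "card D < card A"
        using DA finite_subset[OF subgroup.subset[OF s(1)] fin] psubset_card_mono by blast
      ultimately show False by simp
    qed
    then obtain C where C: "maximal_subgroup C G" "normalizer G D \<subseteq> C"
      using ex_maximal_subgroup[OF fin normalizer_imp_subgroup[OF subgroup.subset[OF sD]]] by blast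
    have DC: "D \<subseteq> C" using subset_normalizer[OF fin sD] C by blast
    \<comment> \<open>A maximal \<open>C\<close> above the normalizer of \<open>D\<close> meets
      \<open>X'\<close> in more than \<open>D\<close>, against the choice of \<open>D\<close> unless
      \<open>C = X'\<close>. Applied to \<open>A\<close> and to \<open>B\<close>, this gives
      \<open>A = B\<close>.\<close>
    have step: "C = X'" if X': "maximal_subgroup X' G" "D \<subset> X'" "w \<in> X' - D" "w \<in> normalizer G D" for X' w
    proof (rule ccontr)
      assume "C \<noteq> X'"
      moreover have "\<one> \<in> D" using subgroup.one_closed[OF sD] .
      moreover have "C \<inter> X' \<noteq> {\<one>}" using X'(2) DC \<open>\<one> \<in> D\<close> AB(5) by blast
      ultimately have "C \<inter> X' \<in> ?T" using C(1) X'(1) by blast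
      then have "D = C \<inter> X'" by (rule D(2)) (use DC X'(2) in auto)
      then show False using X' C by blast
    qed
    show False using step[OF AB(1) DA x] step[OF AB(2) DB y] AB(3) by simp
  qed
  \<comment> \<open>A conjugate of \<open>M\<close> by an outside element is another maximal
    subgroup, because \<open>M\<close> is its own normalizer; by \<open>triv\<close> the two meet
    trivially.\<close>
  have mal: "malnormal M G" if M: "maximal_subgroup M G" for M
  proof -
    have sM: "subgroup M G" using maximal_subgroup_imp_subgroup[OF M] .
    have "h = \<one>" if *: "g \<in> carrier G - M" "h \<in> M" "g \<otimes> h \<otimes> inv g \<in> M" for g h
    proof -
      let ?M = "(\<lambda>h. g \<otimes> h \<otimes> inv g) ` M"
      have g: "g \<in> carrier G" using * by blast
      have hc: "h \<in> carrier G" using * subgroup.mem_carrier[OF sM] by blast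
      have max: "maximal_subgroup ?M G" using maximal_subgroup_iso_image[OF conj_iso[OF g] is_group M] .
      have "?M \<noteq> M"
      proof
        assume "?M = M"
        then have "g \<in> normalizer G M" using mem_normalizer_iff[OF fin sM] g by blast
        then show False using sn[OF M] * by blast
      qed
      then have "?M \<inter> M = {\<one>}" using triv[OF max M] by blast
      then have "g \<otimes> h \<otimes> inv g = \<one>" using * by blast
      then have "\<one> = g \<otimes> h \<otimes> inv g" by simp
      then have "g \<otimes> h = g" using g hc by (simp add: inv_solve_right)
      then show ?thesis using g hc by simp
    qed
    then show ?thesis using sM by (auto simp: malnormal_def)
  qed
  have ex: "\<exists>A a. maximal_subgroup A G \<and> A \<noteq> {\<one>} \<and> card A = p ^ a"
    if p: "Factorial_Ring.prime p" "p dvd order G" for p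
  proof -
    obtain z where z: "z \<in> carrier G" "ord z = p"
      using cauchy[OF fin subgroup_self] p by (auto simp: order_def)
    note Z = generate_singleton[OF z(1)]
    have "generate G {z} \<noteq> carrier G" using Z(3) z(2) npo[OF p(1), of 1] by (auto simp: order_def)
    then obtain A where A: "maximal_subgroup A G" "generate G {z} \<subseteq> A" using ex_maximal_subgroup[OF fin Z(1)] by blast
    have sA: "subgroup A G" using maximal_subgroup_imp_subgroup[OF A(1)] .
    have pA: "p dvd card A" using card_subgroup_dvd[OF Z(1) sA A(2)] Z(3) z(2) by simp
    obtain r a where r: "Factorial_Ring.prime (r::nat)" "card A = r ^ a" using maxc A(1) by blast
    have "p = r" using prime_dvd_prime_power[OF p(1) r(1)] pA r(2) by simp
    moreover have "A \<noteq> {\<one>}" using pA p(1) by auto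
    ultimately show ?thesis using A r by blast
  qed
  \<comment> \<open>Starting from the prime 2 is just a way of getting a first prime divisor; the
    second is chosen different from it.\<close>
  obtain p where p: "Factorial_Ring.prime p" "p dvd order G" using other[OF two_is_prime_nat] by blast
  obtain q where q: "Factorial_Ring.prime q" "q dvd order G" "q \<noteq> p" using other[OF p(1)] by blast
  obtain A a where A: "maximal_subgroup A G" "A \<noteq> {\<one>}" "card A = p ^ a" using ex[OF p] by blast
  obtain B b where B: "maximal_subgroup B G" "B \<noteq> {\<one>}" "card B = q ^ b" using ex[OF q(1,2)] by blast
  have "coprime (card A) (card B)" using A B p q by (simp add: primes_coprime)
  then show False using malnormal_not_coprime[OF fin mal[OF A(1)] A(2) mal[OF B(1)] B(2)] by simp
qed

text \<open>The normal maximal subgroup \<open>P\<close> is a p-group, and a subgroup of order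
  \<open>q\<close> complements it. Then \<open>P\<close> is minimal normal in \<open>G\<close>,
  which forces it to equal the derived subgroup, its own centre and its set of elements killed by
  \<open>p\<close>.\<close>

lemma non_nilpotent_proper_subgroups_prime_power_structure:
  assumes fin: "finite (carrier G)" and pp: "proper_subgroups_prime_power G" and nn: "\<not> nilpotent_group G"
  obtains p q a :: nat and P where
    "Factorial_Ring.prime p" "Factorial_Ring.prime q" "p \<noteq> q" "a \<ge> 1"
    "P \<lhd> G" "maximal_subgroup P G" "card P = p ^ a" "order G = p ^ a * q"
    "derived G (carrier G) = P" "elementary_abelian p (G\<lparr>carrier := P\<rparr>)" "comm_group (G Mod P)"
    "\<forall>H. subgroup H G \<longrightarrow> card H = q \<longrightarrow> maximal_subgroup H G \<and> \<not> H \<lhd> G \<and> P <#> H = carrier G"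
proof -
  obtain P where P: "maximal_subgroup P G" "P \<lhd> G" using ex_normal_maximal_subgroup[OF fin pp nn] by blast
  have sP: "subgroup P G" and Pc: "P \<noteq> carrier G" using P by (auto simp: maximal_subgroup_def)
  have npo: "order G \<noteq> p ^ k" if "Factorial_Ring.prime p" for p k
    using p_group_nilpotent[OF that] nn by blast
  have pos: "order G > 0" using fin order_gt_0_iff_finite by simp
  have finP: "finite P" using finite_subset[OF subgroup.subset[OF sP] fin] .
  obtain p a where pa: "Factorial_Ring.prime (p::nat)" "card P = p ^ a"
    using pp sP Pc unfolding proper_subgroups_prime_power_def by blast
  obtain q where q: "Factorial_Ring.prime q" "q dvd order G" "q \<noteq> p"
    using ex_other_prime_factor[OF pos pa(1) npo[OF pa(1)]] by blast
  have cop: "coprime (p ^ a) q" using pa q by (simp add: primes_coprime)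
  have mult: "P <#> H = carrier G" if H: "subgroup H G" "card H = q" for H
  proof -
    note E = set_mult_normal_subgroup[OF P(2) H(1)]
    have "P <#> H \<noteq> P"
    proof
      assume "P <#> H = P"
      then have "q dvd p ^ a" using card_subgroup_dvd[OF H(1) sP] E(3) H(2) pa(2) by simp
      then show False using prime_dvd_prime_power[OF q(1) pa(1)] q(3) by blast
    qed
    then show ?thesis using P(1) E(1,2) unfolding maximal_subgroup_def by blast
  qed
  obtain z where z: "z \<in> carrier G" "ord z = q"
    using cauchy[OF fin subgroup_self] q by (auto simp: order_def)
  define Q where "Q = generate G {z}"
  have Q: "subgroup Q G" "card Q = q" using generate_singleton[OF z(1)] z(2) by (auto simp: Q_def)
  have o: "order G = p ^ a * q"
    using order_eq_of_set_mult[OF fin sP Q(1) _ mult[OF Q]] pa(2) Q(2) cop by simp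
  have a: "a \<ge> 1" using o npo[OF q(1), of 1] by (cases a) auto
  have H: "maximal_subgroup H G \<and> \<not> H \<lhd> G \<and> P <#> H = carrier G" if H: "subgroup H G" "card H = q" for H
  proof -
    \<comment> \<open>A proper overgroup of \<open>H\<close> has prime power order, hence a power of
      \<open>q\<close>; as it divides \<open>p ^ a * q\<close>, it is \<open>q\<close>.\<close>
    have "maximal_subgroup H G" unfolding maximal_subgroup_def
    proof (intro conjI allI impI)
      show "H \<noteq> carrier G" using H(2) npo[OF q(1), of 1] by (auto simp: order_def)
      fix K assume K: "subgroup K G \<and> H \<subseteq> K"
      show "K = H \<or> K = carrier G"
      proof (rule disjCI)
        assume "K \<noteq> carrier G"
        then obtain r n where r: "Factorial_Ring.prime (r::nat)" "card K = r ^ n"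
          using pp K unfolding proper_subgroups_prime_power_def by blast
        have "q dvd r ^ n" using card_subgroup_dvd[OF H(1), of K] K r(2) H(2) by simp
        then have rq: "q = r" using prime_dvd_prime_power q(1) r(1) by blast
        have "card K dvd p ^ a * q" using card_subgroup_dvd_order[of K] K o by simp
        moreover have "coprime (card K) (p ^ a)" using r(2) rq q(1,3) pa(1) by (simp add: primes_coprime)
        ultimately have "card K dvd q" by (simp add: coprime_dvd_mult_right_iff)
        then have "card K \<le> card H" using H(2) q(1) by (simp add: dvd_imp_le prime_gt_0_nat)
        moreover have "finite K" using K finite_subset[OF subgroup.subset fin] by blast
        ultimately show "K = H" using K card_seteq by metis
      qed
    qed (rule H(1))
    \<comment> \<open>A normal \<open>H\<close> would make \<open>G\<close> the direct product of
      \<open>P\<close> and \<open>H\<close>, which is nilpotent.\<close>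
    moreover have "\<not> H \<lhd> G"
      using nilpotent_of_normal_sylow_and_prime[OF fin P(2) pa(2,1) _ H(2) q(1) _ mult[OF H]] q(3) nn by blast
    ultimately show ?thesis using mult[OF H] by blast
  qed
  \<comment> \<open>The product of \<open>N\<close> and \<open>Q\<close> has order divisible by
    \<open>p\<close> and \<open>q\<close>, so it is \<open>G\<close>; comparing orders gives |N| =
    |P|.\<close>
  have min: "N = P" if N: "N \<lhd> G" "N \<subseteq> P" "N \<noteq> {\<one>}" for N
  proof -
    have sN: "subgroup N G" using normal_imp_subgroup[OF N(1)] .
    have "card N \<noteq> 1" using card_subgroup_eq_1_iff[OF sN] N by simp
    moreover obtain i where i: "card N = p ^ i"
      using card_subgroup_dvd[OF sN sP N(2)] pa divides_primepow_nat by metis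
    ultimately have "p dvd card N" by (cases i) auto
    note E = set_mult_normal_subgroup[OF N(1) Q(1)]
    have "p dvd card (N <#> Q)" using card_subgroup_dvd[OF sN E(1,2)] \<open>p dvd card N\<close> dvd_trans by blast
    moreover have "q dvd card (N <#> Q)" using card_subgroup_dvd[OF Q(1) E(1,3)] Q(2) by simp
    ultimately have eq: "N <#> Q = carrier G"
      using prime_power_subgroup_not_two_primes[OF pp E(1) pa(1) q(1)] q(3) by blast
    have "coprime (card N) (card Q)" using i Q(2) pa q by (simp add: primes_coprime)
    then have "card N * q = card P * q"
      using order_eq_of_set_mult[OF fin sN Q(1) _ eq] o Q(2) pa(2) by metis
    then have "card N = card P" using prime_gt_0_nat[OF q(1)] by simp
    then show ?thesis using N(2) finP card_subset_eq by blast
  qed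
  interpret GP: group "G\<lparr>carrier := P\<rparr>" by (rule subgroup_imp_group[OF sP])
  have "order (G Mod P) = q"
    using lagrange[OF sP] o pa prime_gt_0_nat[OF pa(1)] by (simp add: order_def FactGroup_def)
  then have commQ: "comm_group (G Mod P)"
    using group.comm_group_of_prime_order[OF normal.factorgroup_is_group[OF P(2)]] q(1) by simp
  have der: "derived G (carrier G) = P"
  proof (rule min)
    show "derived G (carrier G) \<lhd> G" by (rule derived_self_is_normal)
    show "derived G (carrier G) \<subseteq> P" using derived_minimal[OF P(2) commQ] .
    show "derived G (carrier G) \<noteq> {\<one>}"
    proof
      assume d: "derived G (carrier G) = {\<one>}"
      have "comm_group G"
      proof (rule group_comm_groupI)
        fix x y assume xy: "x \<in> carrier G" "y \<in> carrier G"
        then have "x \<otimes> y \<otimes> inv x \<otimes> inv y \<in> derived G (carrier G)"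
          unfolding derived_def by (intro generate.incl) blast
        then have "\<one> = (x \<otimes> y) \<otimes> inv (y \<otimes> x)" using d xy by (simp add: inv_mult_group m_assoc)
        then show "x \<otimes> y = y \<otimes> x" using xy by (simp add: inv_solve_right)
      qed
      then show False using comm_group_nilpotent nn by blast
    qed
  qed
  have commP: "x \<otimes> y = y \<otimes> x" if xy: "x \<in> P" "y \<in> P" for x y
  proof -
    \<comment> \<open>The centre of \<open>P\<close> is normal in \<open>G\<close> and nontrivial,
      so \<open>min\<close> applies.\<close>
    let ?Z = "{x \<in> P. \<forall>y\<in>P. x \<otimes> y = y \<otimes> x}"
    have sub: "P \<subseteq> carrier G" using subgroup.subset[OF sP] .
    have sZ: "subgroup ?Z G"
    proof (rule subgroup.intro)
      show "?Z \<subseteq> carrier G" using sub by blast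
      show "\<one> \<in> ?Z" using subgroup.one_closed[OF sP] sub by auto
      fix x assume x: "x \<in> ?Z"
      show "inv x \<in> ?Z" 
      proof -
        have "inv x \<otimes> y = y \<otimes> inv x" if y: "y \<in> P" for y
        proof -
          have c: "x \<in> carrier G" "y \<in> carrier G" using x y sub by auto
          have "x \<otimes> y = y \<otimes> x" using x y by blast
          then show ?thesis using c by (metis inv_closed inv_solve_left inv_solve_right m_assoc m_closed)
        qed
        then show ?thesis using x subgroup.m_inv_closed[OF sP] by blast
      qed
      fix x' assume x': "x' \<in> ?Z"
      have "x \<otimes> x' \<otimes> y = y \<otimes> (x \<otimes> x')" if y: "y \<in> P" for y
      proof -
        have c: "x \<in> carrier G" "x' \<in> carrier G" "y \<in> carrier G" using x x' y sub by auto
        have e: "x \<otimes> y = y \<otimes> x" "x' \<otimes> y = y \<otimes> x'" using x x' y by auto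
        have "x \<otimes> x' \<otimes> y = x \<otimes> (y \<otimes> x')" using c e(2) by (simp add: m_assoc)
        also have "\<dots> = (x \<otimes> y) \<otimes> x'" using c by (simp add: m_assoc)
        also have "\<dots> = y \<otimes> (x \<otimes> x')" unfolding e(1) using c by (simp add: m_assoc)
        finally show ?thesis .
      qed
      then show "x \<otimes> x' \<in> ?Z" using x x' subgroup.m_closed[OF sP] by blast
    qed
    have "?Z \<lhd> G"
    proof (rule normal_invI[OF sZ])
      fix g x assume g: "g \<in> carrier G" and x: "x \<in> ?Z"
      have gx: "g \<otimes> x \<otimes> inv g \<in> P" using normal.inv_op_closed2[OF P(2) g] x by blast
      have "g \<otimes> x \<otimes> inv g \<otimes> y = y \<otimes> (g \<otimes> x \<otimes> inv g)" if y: "y \<in> P" for y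
      proof -
        define w where "w = inv g \<otimes> y \<otimes> g"
        have w: "w \<in> P" using normal.inv_op_closed1[OF P(2) g y] by (simp add: w_def)
        have c: "x \<in> carrier G" "w \<in> carrier G" "y \<in> carrier G" using x w y sub by auto
        have yw: "y = g \<otimes> w \<otimes> inv g" using c g
          by (auto simp: w_def m_assoc simp flip: m_assoc[of g "inv g"])
        have e: "x \<otimes> w = w \<otimes> x" using x w by blast
        have cancel: "inv g \<otimes> (g \<otimes> u) = u" if "u \<in> carrier G" for u
          using g that by (simp flip: m_assoc)
        have "g \<otimes> x \<otimes> inv g \<otimes> y = g \<otimes> (x \<otimes> w) \<otimes> inv g"
          unfolding yw using c(1,2) g by (simp add: m_assoc cancel)
        also have "\<dots> = y \<otimes> (g \<otimes> x \<otimes> inv g)"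
          unfolding yw e using c(1,2) g by (simp add: m_assoc cancel)
        finally show ?thesis .
      qed
      then show "g \<otimes> x \<otimes> inv g \<in> ?Z" using gx by blast
    qed
    moreover have "?Z \<noteq> {\<one>}"
    proof -
      obtain x where "x \<in> P - {\<one>}" "\<forall>g\<in>P. g \<otimes> x = x \<otimes> g"
        using GP.p_group_center_nontrivial[OF pa(1)] pa(2) a by (auto simp: order_def)
      then have "x \<in> ?Z" "x \<noteq> \<one>" by auto
      then show ?thesis by blast
    qed
    ultimately have "?Z = P" using min[of ?Z] by blast
    then show ?thesis using xy by blast
  qed
  have expP: "x [^] p = \<one>" if x: "x \<in> P" for x
  proof -
    \<comment> \<open>A subgroup because \<open>P\<close> is abelian, normal in \<open>G\<close>,
      and nontrivial by Cauchy's theorem; again \<open>min\<close> applies.\<close>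
    let ?E = "{x \<in> P. x [^] p = \<one>}"
    have sub: "P \<subseteq> carrier G" using subgroup.subset[OF sP] .
    have sE: "subgroup ?E G"
    proof (rule subgroup.intro)
      show "?E \<subseteq> carrier G" using sub by blast
      show "\<one> \<in> ?E" using subgroup.one_closed[OF sP] by simp
      fix x assume x: "x \<in> ?E"
      then have c: "x \<in> carrier G" using sub by blast
      show "inv x \<in> ?E" using x c subgroup.m_inv_closed[OF sP] by (simp add: nat_pow_inv)
      fix y assume y: "y \<in> ?E"
      then have "(x \<otimes> y) [^] p = x [^] p \<otimes> y [^] p"
        using x c sub commP by (intro pow_mult_distrib) auto
      then show "x \<otimes> y \<in> ?E" using x y subgroup.m_closed[OF sP] by simp
    qed
    have "?E \<lhd> G"
    proof (rule normal_invI[OF sE])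
      fix g x assume g: "g \<in> carrier G" and x: "x \<in> ?E"
      have gx: "g \<otimes> x \<otimes> inv g \<in> P" using normal.inv_op_closed2[OF P(2) g] x by blast
      interpret f: group_hom G G "\<lambda>h. g \<otimes> h \<otimes> inv g"
        using conj_iso[OF g] by (simp add: group_hom_def group_hom_axioms_def iso_def is_group)
      have "(g \<otimes> x \<otimes> inv g) [^] p = g \<otimes> (x [^] p) \<otimes> inv g"
        using f.hom_nat_pow[of x p] x sub by auto
      then show "g \<otimes> x \<otimes> inv g \<in> ?E" using gx x g by simp
    qed
    moreover have "?E \<noteq> {\<one>}"
    proof -
      have "p dvd card P" using pa(2) a by simp
      then obtain x where x: "x \<in> P" "ord x = p" using cauchy[OF fin sP pa(1)] by blast
      then have "x \<in> ?E" using pow_ord_eq_1[of x] sub by auto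
      moreover have "x \<noteq> \<one>" using x(2) pa(1) by auto
      ultimately show ?thesis by blast
    qed
    ultimately have "?E = P" using min[of ?E] by blast
    then show ?thesis using x by blast
  qed
  have "comm_group (G\<lparr>carrier := P\<rparr>)"
    by (rule GP.group_comm_groupI) (use commP in simp)
  then have el: "elementary_abelian p (G\<lparr>carrier := P\<rparr>)"
    using pa(1) expP by (simp add: elementary_abelian_def flip: nat_pow_consistent)
  show thesis
    by (rule that[OF pa(1) q(1) _ a P(2,1) pa(2) o der el commQ]) (use q(3) H in auto)
qed

end

section \<open>The main theorem\<close>

context group begin

lemma ex_maximal_subgroup_FactGroup_core_notin:
  assumes F: "formation F" "saturated F" "contains_nilpotent_groups F"
    and fin: "finite (carrier G)" and nF: "\<not> in_class F G"
  obtains M where "maximal_subgroup M G" "\<not> in_class F (G Mod core G M)"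
  using in_class_FactGroup_frattini[OF F(1,3) fin] in_class_of_FactGroup_frattini[OF F(1,2) fin] nF
  by blast

lemma proper_subgroups_prime_power_of_subnormal_or_self_normalizing:
  assumes F: "formation F" "saturated F" "contains_nilpotent_groups F"
    and fin: "finite (carrier G)" and nF: "\<not> in_class F G"
    and hyp: "\<And>H. primary_cyclic_subgroup H G \<Longrightarrow> abs_F_subnormal F H G \<or> self_normalizing H G"
  shows "proper_subgroups_prime_power G"
proof -
  obtain M where M: "maximal_subgroup M G" "\<not> in_class F (G Mod core G M)"
    using ex_maximal_subgroup_FactGroup_core_notin[OF F fin nF] .
  have sM: "subgroup M G" and Mc: "M \<noteq> carrier G" using M by (auto simp: maximal_subgroup_def)
  have finM: "finite M" using finite_subset[OF subgroup.subset[OF sM] fin] .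
  \<comment> \<open>The last step of a chain from \<open>M\<close> could only start at
    \<open>M\<close>, whose core quotient is outside the class.\<close>
  have not_sub: "\<not> F_subnormal F M G"
  proof
    assume "F_subnormal F M G"
    then obtain N where "maximal_subgroup N G" "M \<subseteq> N" "in_class F (G Mod core G N)"
      using F_subnormal_imp_maximal Mc by blast
    then show False using M unfolding maximal_subgroup_def by blast
  qed
  have selfn: "self_normalizing H G" if "primary_cyclic_subgroup H G" "H \<subseteq> M" for H
    using hyp[OF that(1)] that(2) not_sub sM unfolding abs_F_subnormal_def by blast
  \<comment> \<open>If the trivial subgroup were maximal, any nontrivial element would generate
    \<open>G\<close>; a cyclic group is nilpotent and lies in the class.\<close>
  have M1: "M \<noteq> {\<one>}"
  proof
    assume e: "M = {\<one>}"
    then obtain x where x: "x \<in> carrier G" "x \<noteq> \<one>" using Mc by blast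
    note X = generate_singleton[OF x(1)]
    have "generate G {x} = M \<or> generate G {x} = carrier G"
      using M(1) X(1) e subgroup.one_closed[OF X(1)] unfolding maximal_subgroup_def by blast
    then have "generate G {x} = carrier G" using e x X(2) by auto
    then have "comm_group G" using comm_group_of_generate_singleton x by blast
    then show False using in_class_nilpotent[OF F(3) fin] comm_group_nilpotent nF by blast
  qed
  then have "card M \<noteq> 1" using card_subgroup_eq_1_iff[OF sM] by simp
  then obtain r where r: "Factorial_Ring.prime r" "r dvd card M" using prime_factor_nat by blast
  have cyc: "\<exists>H. subgroup H G \<and> H \<subseteq> K \<and> card H = s \<and> primary_cyclic_subgroup H G"
    if sK: "Factorial_Ring.prime s" "subgroup K G" "s dvd card K" for s K
  proof -
    obtain x where x: "x \<in> K" "ord x = s" using cauchy[OF fin sK(2,1,3)] by blast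
    have xc: "x \<in> carrier G" using x(1) subgroup.mem_carrier[OF sK(2)] by blast
    have "primary_cyclic_subgroup (generate G {x}) G"
      using primary_cyclic_subgroup_generate[OF xc _ sK(1), of 1] x(2) by simp
    then show ?thesis
      using generate_singleton[OF xc] generate_singleton_subset[OF sK(2) x(1)] x(2) by blast
  qed
  obtain H where H: "subgroup H G" "H \<subseteq> M" "card H = r" "primary_cyclic_subgroup H G"
    using cyc[OF r(1) sM r(2)] by blast
  have nH: "self_normalizing H G" using selfn H by blast
  have mal: "malnormal K G \<and> K \<noteq> {\<one>}" if "self_normalizing K G" "card K = s" "Factorial_Ring.prime s" for K s
    using malnormal_of_self_normalizing_prime_card[OF fin that(1)] that by auto
  \<comment> \<open>Self-normalizing subgroups of two different prime orders would be malnormal of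
    coprime orders.\<close>
  have uniq: "s = r" if "self_normalizing K G" "card K = s" "Factorial_Ring.prime s" for K s
  proof (rule ccontr)
    assume "s \<noteq> r"
    then have "coprime (card H) (card K)" using that H(3) r(1) by (simp add: primes_coprime)
    then show False using malnormal_not_coprime[OF fin] mal[OF nH H(3) r(1)] mal[OF that] by blast
  qed
  let ?m = "card (rcosets H)"
  have o: "order G = ?m * r" using lagrange[OF H(1)] H(3) by simp
  \<comment> \<open>Otherwise the normalizer of \<open>H\<close> would be larger than
    \<open>H\<close>. So \<open>H\<close> is a full Sylow subgroup of order
    \<open>r\<close>.\<close>
  have rm: "\<not> r dvd ?m"
  proof
    assume "r dvd ?m"
    then obtain g where "g \<in> carrier G - H" "\<forall>h\<in>H. g \<otimes> h \<otimes> inv g \<in> H"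
      using normalizing_element_outside_p_subgroup[OF H(1) fin r(1), of 1] H(3) by auto
    then have "g \<in> normalizer G H" "g \<notin> H" using mem_normalizer_iff[OF fin H(1)] by auto
    then show False using nH by (simp add: self_normalizing_def)
  qed
  \<comment> \<open>By \<open>uniq\<close> no other prime divides the order of \<open>M\<close>, and
    by \<open>rm\<close> the square of \<open>r\<close> does not divide |G|.\<close>
  have cM: "card M = r"
  proof -
    have "\<exists>k. card M = r ^ k"
    proof (rule ccontr)
      assume *: "\<nexists>k. card M = r ^ k"
      have "card M > 0" using subgroup.finite_imp_card_positive[OF sM fin] .
      then obtain s where s: "Factorial_Ring.prime s" "s dvd card M" "s \<noteq> r"
        using ex_other_prime_factor r(1) * by blast
      then obtain K where "K \<subseteq> M" "card K = s" "primary_cyclic_subgroup K G" using cyc[OF s(1) sM s(2)] by blast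
      then show False using uniq selfn s by blast
    qed
    then obtain k where k: "card M = r ^ k" by blast
    have "k < 2"
    proof (rule ccontr)
      assume "\<not> k < 2"
      then have "r ^ 2 dvd r ^ k" by (simp add: le_imp_power_dvd)
      then have "r ^ 2 dvd ?m * r" using card_subgroup_dvd_order[OF sM] k o dvd_trans by metis
      then have "r * r dvd ?m * r" by (simp add: power2_eq_square)
      then show False using rm prime_gt_0_nat[OF r(1)] by simp
    qed
    moreover have "k \<noteq> 0" using k \<open>card M \<noteq> 1\<close> by (cases k) auto
    ultimately have "k = 1" by simp
    then show ?thesis using k by simp
  qed
  have HM: "H = M" using card_subset_eq[OF finM H(2)] H(3) cM by simp
  have nM: "\<not> M \<lhd> G" using self_normalizing_imp_not_normal[OF fin] nH HM Mc by blast
  \<comment> \<open>Sylow conjugacy: \<open>Z\<close> is a conjugate of \<open>M\<close> and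
    inherits both properties.\<close>
  have sub_r: "maximal_subgroup Z G \<and> \<not> Z \<lhd> G" if Z: "subgroup Z G" "card Z = r" for Z
  proof -
    obtain g where g: "g \<in> carrier G" "\<forall>h\<in>Z. g \<otimes> h \<otimes> inv g \<in> M"
      using sylow_conj[OF Z(1) sM fin r(1), of 1] Z(2) rm HM by auto
    let ?f = "\<lambda>h. g \<otimes> h \<otimes> inv g" and ?f' = "\<lambda>h. inv g \<otimes> h \<otimes> inv (inv g)"
    have img: "?f ` Z = M"
      using card_subset_eq[OF finM, of "?f ` Z"] g(2) conj_subgroup(2)[OF g(1) Z(1)] Z(2) cM by auto
    have "?f' (?f z) = z" if "z \<in> Z" for z
      using that subgroup.mem_carrier[OF Z(1)] g(1) by (simp add: m_assoc) (simp flip: m_assoc)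
    then have "?f' ` ?f ` Z = Z" by (simp add: image_image)
    then have eq: "?f' ` M = Z" using img by simp
    have "maximal_subgroup Z G"
      using maximal_subgroup_iso_image[OF conj_iso[of "inv g"] is_group M(1)] g(1) eq by simp
    moreover have "\<not> Z \<lhd> G"
    proof
      assume n: "Z \<lhd> G"
      have "?f ` Z \<subseteq> Z" using normal.inv_op_closed2[OF n g(1)] by blast
      then have "M \<subseteq> Z" using img by simp
      moreover have "finite Z" using finite_subset[OF subgroup.subset[OF Z(1)] fin] .
      ultimately have "M = Z" using card_subset_eq[of Z M] Z(2) cM by simp
      then show False using n nM by simp
    qed
    ultimately show ?thesis by blast
  qed
  have "?m \<noteq> 1"
  proof
    assume "?m = 1"
    then have "card M = card (carrier G)" using o cM by (simp add: order_def)
    then show False using card_subset_eq[OF fin subgroup.subset[OF sM]] Mc by blast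
  qed
  then obtain p where p: "Factorial_Ring.prime p" "p dvd ?m" using prime_factor_nat by blast
  have pr: "p \<noteq> r" using p rm by auto
  have pG: "p dvd order G" using p o by simp
  have pos: "order G \<noteq> 0" using fin order_gt_0_iff_finite by simp
  have "\<not> is_unit p" using p(1) by auto
  then obtain m' where m': "order G = p ^ multiplicity p (order G) * m'" "\<not> p dvd m'"
    using multiplicity_decompose'[OF pos] by blast
  define a where "a = multiplicity p (order G)"
  have a0: "a \<noteq> 0" using m' pG unfolding a_def by (metis mult_1 power_0)
  obtain P where P: "subgroup P G" "card P = p ^ a"
    using sylow_thm[OF p(1) is_group _ fin] m'(1) unfolding a_def by blast
  have finP: "finite P" using finite_subset[OF subgroup.subset[OF P(1)] fin] .
  have rP: "\<not> r dvd card P" using prime_dvd_prime_power[OF r(1) p(1)] P(2) pr by auto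
  have copP: "coprime (card P) r" using P(2) p(1) r(1) pr by (simp add: primes_coprime)
  have Pc: "P \<noteq> carrier G" using rP o by (auto simp: order_def)
  have pP: "p dvd card P" using P(2) a0 by simp
  obtain Y where Y: "subgroup Y G" "Y \<subseteq> P" "card Y = p" "primary_cyclic_subgroup Y G"
    using cyc[OF p(1) P(1) pP] by blast
  \<comment> \<open>As \<open>p\<close> differs from \<open>r\<close>, \<open>uniq\<close> excludes
    that \<open>Y\<close> is self-normalizing. Absolute subnormality then passes to the overgroup
    \<open>P\<close>.\<close>
  then have "abs_F_subnormal F Y G" using hyp uniq p(1) pr by blast
  then have "F_subnormal F P G" using P(1) Y(2) unfolding abs_F_subnormal_def by blast
  then obtain N where N: "maximal_subgroup N G" "P \<subseteq> N" "in_class F (G Mod core G N)"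
    using F_subnormal_imp_maximal Pc by blast
  have sN: "subgroup N G" and Nc: "N \<noteq> carrier G" using N by (auto simp: maximal_subgroup_def)
  define K where "K = core G N"
  have K: "K \<lhd> G" "K \<subseteq> N" using core_normal[OF sN] by (auto simp: K_def)
  have sK: "subgroup K G" using normal_imp_subgroup[OF K(1)] .
  have Kc: "K \<noteq> carrier G" using K(2) Nc subgroup.subset[OF sN] by blast
  \<comment> \<open>With a trivial core the quotient would be a copy of \<open>G\<close>, which is
    outside the class.\<close>
  have K1: "K \<noteq> {\<one>}"
  proof
    assume "K = {\<one>}"
    then have "in_class F (G Mod {\<one>})" using N(3) by (simp add: K_def)
    moreover have "G \<cong> G Mod {\<one>}"
      using group.iso_sym[OF normal.factorgroup_is_group[OF one_is_normal] is_isoI[OF trivial_factor_iso]] .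
    ultimately show False using in_class_iso nF by blast
  qed
  \<comment> \<open>A subgroup of order \<open>r\<close> inside \<open>K\<close> would be maximal in
    \<open>G\<close>, hence equal to \<open>K\<close>, but it is not normal. With \<open>K1\<close>
    this makes \<open>K\<close> a normal complement of \<open>M\<close>.\<close>
  have rK: "\<not> r dvd card K"
  proof
    assume "r dvd card K"
    then obtain Z where Z: "subgroup Z G" "Z \<subseteq> K" "card Z = r" using cyc[OF r(1) sK] by blast
    then have "K = Z" using sub_r[OF Z(1,3)] sK Kc unfolding maximal_subgroup_def by blast
    then show False using sub_r[OF Z(1,3)] K(1) by blast
  qed
  have copK: "coprime (card K) (card M)" using rK r(1) cM by (simp add: coprime_commute prime_imp_coprime)
  note E = set_mult_normal_subgroup[OF K(1) sM]
  have "K <#> M \<noteq> M"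
  proof
    assume "K <#> M = M"
    then have "K \<inter> M = K" using E(2) by blast
    then show False using coprime_card_imp_Int_trivial[OF sK sM copK] K1 by simp
  qed
  then have KM: "K <#> M = carrier G" using M(1) E(1,3) unfolding maximal_subgroup_def by blast
  have oK: "order G = card K * r" using order_eq_of_set_mult[OF fin sK sM copK KM] cM by simp
  have iK: "card (rcosets K) = r"
    using lagrange[OF sK] oK subgroup.finite_imp_card_positive[OF sK fin] by simp
  have PK: "P \<subseteq> K" using coprime_index_imp_subset_normal[OF K(1) P(1)] copP iK by simp
  have "\<not> M \<subseteq> K" using card_subgroup_dvd[OF sM sK] cM rK by auto
  then obtain x where x: "x \<in> M" "x \<notin> K" by blast
  have xc: "x \<in> carrier G" using x(1) subgroup.mem_carrier[OF sM] by blast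
  \<comment> \<open>Frattini argument: \<open>P\<close> and its conjugate by \<open>x\<close> are
    Sylow subgroups of \<open>K\<close>, so some \<open>k\<close> in \<open>K\<close> conjugates the
    latter back to \<open>P\<close>. The product of \<open>k\<close> and \<open>x\<close> normalizes
    \<open>P\<close> and stays outside \<open>K\<close>.\<close>
  obtain y where y: "y \<in> normalizer G P" "y \<notin> K"
  proof -
    let ?P = "(\<lambda>h. x \<otimes> h \<otimes> inv x) ` P"
    note cP = conj_subgroup[OF xc P(1)]
    have "?P \<subseteq> K" using normal.inv_op_closed2[OF K(1) xc] PK by blast
    then have sP': "subgroup ?P (G\<lparr>carrier := K\<rparr>)" using subgroup_incl[OF cP(1) sK] by simp
    have sPK: "subgroup P (G\<lparr>carrier := K\<rparr>)" using subgroup_incl[OF P(1) sK PK] .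
    interpret GK: group "G\<lparr>carrier := K\<rparr>" by (rule subgroup_imp_group[OF sK])
    let ?i = "card (rcosets\<^bsub>G\<lparr>carrier := K\<rparr>\<^esub> P)"
    have l: "?i * card P = card K" using GK.lagrange[OF sPK] by (simp add: order_def)
    have "\<not> p dvd ?i"
    proof
      assume "p dvd ?i"
      then have "p * p ^ a dvd card K" using l P(2) by (metis dvd_refl mult_dvd_mono)
      then have "p * p ^ a dvd order G" using oK by simp
      then have "p dvd m'" using m'(1) p(1) unfolding a_def[symmetric] by (auto simp: mult.commute[of p])
      then show False using m'(2) by simp
    qed
    moreover have "finite (carrier (G\<lparr>carrier := K\<rparr>))"
      using finite_subset[OF subgroup.subset[OF sK] fin] by simp
    moreover have "card ?P = p ^ a" using cP(2) P(2) by simp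
    ultimately obtain k where k: "k \<in> K" "\<forall>h\<in>?P. k \<otimes>\<^bsub>G\<lparr>carrier := K\<rparr>\<^esub> h \<otimes>\<^bsub>G\<lparr>carrier := K\<rparr>\<^esub> inv\<^bsub>G\<lparr>carrier := K\<rparr>\<^esub> k \<in> P"
      using GK.sylow_conj[OF sP' sPK _ p(1)] by auto
    have kc: "k \<in> carrier G" using k(1) subgroup.mem_carrier[OF sK] by blast
    have k2: "k \<otimes> (x \<otimes> h \<otimes> inv x) \<otimes> inv k \<in> P" if "h \<in> P" for h
      using k that m_inv_consistent[OF sK k(1)] by auto
    have "(k \<otimes> x) \<otimes> h \<otimes> inv (k \<otimes> x) \<in> P" if h: "h \<in> P" for h
      using k2[OF h] kc xc subgroup.mem_carrier[OF P(1) h] by (simp add: inv_mult_group m_assoc)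
    then have "k \<otimes> x \<in> normalizer G P" using mem_normalizer_iff[OF fin P(1)] kc xc by simp
    moreover have "k \<otimes> x \<notin> K"
    proof
      assume "k \<otimes> x \<in> K"
      then have "inv k \<otimes> (k \<otimes> x) \<in> K"
        using subgroup.m_closed[OF sK subgroup.m_inv_closed[OF sK k(1)]] by blast
      then show False using kc xc x(2) by (simp flip: m_assoc)
    qed
    ultimately show ?thesis using that by blast
  qed
  have sNP: "subgroup (normalizer G P) G" using normalizer_imp_subgroup[OF subgroup.subset[OF P(1)]] .
  \<comment> \<open>Otherwise its order would be coprime to the index \<open>r\<close> of
    \<open>K\<close>, which would force \<open>y\<close> into \<open>K\<close>.\<close>
  have "r dvd card (normalizer G P)"
  proof (rule ccontr)
    assume "\<not> r dvd card (normalizer G P)"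
    then have "coprime (card (normalizer G P)) (card (rcosets K))"
      using r(1) iK by (simp add: coprime_commute prime_imp_coprime)
    then show False
      using coprime_index_imp_mem_normal[OF K(1) subgroup.mem_carrier[OF sNP y(1)] pow_card_subgroup[OF sNP y(1)]] y(2)
      by blast
  qed
  then obtain Z where Z: "subgroup Z G" "Z \<subseteq> normalizer G P" "card Z = r" using cyc[OF r(1) sNP] by blast
  have Zm: "maximal_subgroup Z G" using sub_r[OF Z(1,3)] by blast
  have "\<not> P \<subseteq> Z"
  proof
    assume "P \<subseteq> Z"
    then have "p dvd r" using card_subgroup_dvd[OF P(1) Z(1)] Z(3) pP dvd_trans by metis
    then show False using p(1) r(1) pr primes_dvd_imp_eq by blast
  qed
  \<comment> \<open>The normalizer contains the maximal subgroup \<open>Z\<close> and also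
    \<open>P\<close>, which is not inside \<open>Z\<close>; so it is all of
    \<open>G\<close>.\<close>
  then have "normalizer G P \<noteq> Z" using subset_normalizer[OF fin P(1)] by blast
  then have "normalizer G P = carrier G" using Zm sNP Z(2) unfolding maximal_subgroup_def by blast
  then have nP: "P \<lhd> G" using normal_iff_normalizer[OF fin P(1)] by simp
  note E = set_mult_normal_subgroup[OF nP Z(1)]
  have "P <#> Z \<noteq> Z" using E(2) \<open>\<not> P \<subseteq> Z\<close> by auto
  then have "P <#> Z = carrier G" using Zm E(1,3) unfolding maximal_subgroup_def by blast
  then have oP: "order G = p ^ a * r"
    using order_eq_of_set_mult[OF fin P(1) Z(1)] copP Z(3) P(2) by simp
  show ?thesis unfolding proper_subgroups_prime_power_def
  proof (intro allI impI, elim conjE)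
    fix L assume L: "subgroup L G" "L \<noteq> carrier G"
    show "\<exists>s n. Factorial_Ring.prime (s::nat) \<and> card L = s ^ n"
    \<comment> \<open>A proper subgroup of order divisible by \<open>r\<close> contains a maximal
      subgroup of order \<open>r\<close> and equals it; the order of any other divides
      \<open>p ^ a\<close>.\<close>
    proof (cases "r dvd card L")
      case True
      then obtain Z where Z: "subgroup Z G" "Z \<subseteq> L" "card Z = r" using cyc[OF r(1) L(1)] by blast
      then have "L = Z" using sub_r[OF Z(1,3)] L unfolding maximal_subgroup_def by blast
      then have "card L = r ^ 1" using Z(3) by simp
      then show ?thesis using r(1) by blast
    next
      case False
      then have "coprime (card L) r" using r(1) by (simp add: coprime_commute prime_imp_coprime)
      moreover have "card L dvd p ^ a * r" using card_subgroup_dvd_order[OF L(1)] oP by simp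
      ultimately have "card L dvd p ^ a" by (simp add: coprime_dvd_mult_left_iff)
      then show ?thesis using divides_primepow_nat[OF p(1)] p(1) by blast
    qed
  qed
qed

lemma subnormal_or_self_normalizing_of_proper_subgroups_prime_power:
  assumes F: "contains_nilpotent_groups F"
    and fin: "finite (carrier G)" and pp: "proper_subgroups_prime_power G" and nn: "\<not> nilpotent_group G"
    and H: "primary_cyclic_subgroup H G"
  shows "abs_F_subnormal F H G \<or> self_normalizing H G"
proof -
  obtain p q a P where S:
    "Factorial_Ring.prime p" "Factorial_Ring.prime q" "p \<noteq> q" "a \<ge> 1"
    "P \<lhd> G" "maximal_subgroup P G" "card P = p ^ a" "order G = p ^ a * q"
    "derived G (carrier G) = P" "elementary_abelian p (G\<lparr>carrier := P\<rparr>)" "comm_group (G Mod P)"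
    "\<forall>H. subgroup H G \<longrightarrow> card H = q \<longrightarrow> maximal_subgroup H G \<and> \<not> H \<lhd> G \<and> P <#> H = carrier G"
    using non_nilpotent_proper_subgroups_prime_power_structure[OF fin pp nn] by blast
  obtain r n where r: "subgroup H G" "Factorial_Ring.prime (r::nat)" "n \<ge> 1" "card H = r ^ n"
    using H unfolding primary_cyclic_subgroup_def by blast
  have rH: "r dvd card H" using r by simp
  have dH: "card H dvd p ^ a * q" using card_subgroup_dvd_order[OF r(1)] S(8) by simp
  have "r dvd p ^ a * q" using dvd_trans[OF rH dH] .
  then have "r dvd p ^ a \<or> r dvd q" using r(2) prime_dvd_mult_iff by blast
  then consider "r = p" | "r = q" using prime_dvd_prime_power[OF r(2) S(1)] primes_dvd_imp_eq[OF r(2) S(2)] by blast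
  then show ?thesis
  proof cases
    case 1
    \<comment> \<open>A proper overgroup of \<open>H\<close> has order a power of \<open>p\<close>,
      coprime to the index \<open>q\<close> of \<open>P\<close>. So it lies in the abelian group
      \<open>P\<close>, and the descent below \<open>P\<close> applies.\<close>
    have "F_subnormal F L G" if L: "subgroup L G" "H \<subseteq> L" for L
    proof (cases "L = carrier G")
      case True
      then show ?thesis using F_subnormal_refl by simp
    next
      case False
      then obtain s k where s: "Factorial_Ring.prime (s::nat)" "card L = s ^ k"
        using pp L(1) unfolding proper_subgroups_prime_power_def by blast
      have "p dvd s ^ k" using card_subgroup_dvd[OF r(1) L] rH 1 s(2) dvd_trans by metis
      then have "p = s" using prime_dvd_prime_power S(1) s(1) by blast
      then have "coprime (card L) q" using s S by (simp add: primes_coprime)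
      moreover have "card (rcosets P) = q"
        using lagrange[OF normal_imp_subgroup[OF S(5)]] S(7,8) prime_gt_0_nat[OF S(1)] by simp
      ultimately have "L \<subseteq> P" using coprime_index_imp_subset_normal[OF S(5) L(1)] by simp
      moreover have "in_class F (G Mod P)" using in_class_comm_FactGroup[OF F fin S(5) S(11)] .
      ultimately show ?thesis
        using F_subnormal_of_normal_comm_maximal[OF F fin S(5,6)] S(10) L(1) by (simp add: elementary_abelian_def)
    qed
    then show ?thesis using r(1) by (simp add: abs_F_subnormal_def)
  next
    case 2
    \<comment> \<open>Since \<open>q\<close> divides |G| only once, \<open>H\<close> has order
      \<open>q\<close> and is therefore maximal and not normal.\<close>
    have "coprime (card H) (p ^ a)" using r 2 S by (simp add: primes_coprime)
    then have "card H dvd q" using dH by (simp add: coprime_dvd_mult_right_iff)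
    then have "card H = q" using rH 2 by (simp add: dvd_antisym)
    then have "maximal_subgroup H G" "\<not> H \<lhd> G" using S(12) r(1) by auto
    then show ?thesis using maximal_subgroup_self_normalizing[OF fin] by blast
  qed
qed

lemma ex_semidirect_structure:
  assumes fin: "finite (carrier G)" and pp: "proper_subgroups_prime_power G" and nn: "\<not> nilpotent_group G"
  shows "\<exists>x\<in>carrier G. \<exists>p\<in>prime_factors (order G). \<exists>q\<in>prime_factors (order G).
    q \<noteq> p
    \<and> is_semidirect_product G (derived G (carrier G)) (generate G {x})
    \<and> elementary_abelian p (G\<lparr>carrier := derived G (carrier G)\<rparr>)
    \<and> maximal_subgroup (generate G {x}) G
    \<and> card (generate G {x}) = q
    \<and> carter_subgroup (generate G {x}) G"
proof -
  obtain p q a P where S: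
    "Factorial_Ring.prime p" "Factorial_Ring.prime q" "p \<noteq> q" "a \<ge> 1"
    "P \<lhd> G" "maximal_subgroup P G" "card P = p ^ a" "order G = p ^ a * q"
    "derived G (carrier G) = P" "elementary_abelian p (G\<lparr>carrier := P\<rparr>)" "comm_group (G Mod P)"
    "\<forall>H. subgroup H G \<longrightarrow> card H = q \<longrightarrow> maximal_subgroup H G \<and> \<not> H \<lhd> G \<and> P <#> H = carrier G"
    using non_nilpotent_proper_subgroups_prime_power_structure[OF fin pp nn] by blast
  \<comment> \<open>Any element of order \<open>q\<close> serves, since all subgroups of order
    \<open>q\<close> are maximal, not normal and complement \<open>P\<close>.\<close>
  obtain x where x: "x \<in> carrier G" "ord x = q"
    using cauchy[OF fin subgroup_self S(2)] S(8) by (auto simp: order_def)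
  let ?Q = "generate G {x}"
  have Q: "subgroup ?Q G" "card ?Q = q" using generate_singleton[OF x(1)] x(2) by auto
  note max = S(12)[rule_format, OF Q]
  have sn: "self_normalizing ?Q G" using maximal_subgroup_self_normalizing[OF fin] max by blast
  interpret GQ: group "G\<lparr>carrier := ?Q\<rparr>" by (rule subgroup_imp_group[OF Q(1)])
  have "comm_group (G\<lparr>carrier := ?Q\<rparr>)" using GQ.comm_group_of_prime_order Q(2) S(2) by (simp add: order_def)
  then have "carter_subgroup ?Q G" using GQ.comm_group_nilpotent sn by (simp add: carter_subgroup_def)
  moreover have "P \<inter> ?Q = {\<one>}"
    using coprime_card_imp_Int_trivial[OF normal_imp_subgroup[OF S(5)] Q(1)] S Q(2) by (simp add: primes_coprime)
  then have "is_semidirect_product G P ?Q" using S(5) Q(1) max by (simp add: is_semidirect_product_def)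
  moreover have pos: "order G \<noteq> 0" using fin order_gt_0_iff_finite by simp
  have "p \<in> prime_factors (order G)" "q \<in> prime_factors (order G)"
    using pos S(1,2,4,8) by (auto simp: in_prime_factors_iff)
  ultimately show ?thesis using x(1) S(3,9,10) Q(2) max by metis
qed

end

theorem theorem4p1:
  fixes F :: "nat monoid set" and G :: "('a, 'b) monoid_scheme"
  assumes "formation F" "subgroup_closed F" "saturated F" "contains_nilpotent_groups F"
    and "group G" "finite (carrier G)" "\<not> in_class F G"
  shows "((\<forall>H. primary_cyclic_subgroup H G \<longrightarrow> abs_F_subnormal F H G \<or> self_normalizing H G)
            \<longleftrightarrow> \<not> nilpotent_group G \<and> proper_subgroups_prime_power G)
       \<and> (\<not> nilpotent_group G \<and> proper_subgroups_prime_power G \<longrightarrow>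
            (\<exists>x\<in>carrier G. \<exists>p\<in>prime_factors (order G). \<exists>q\<in>prime_factors (order G).
               q \<noteq> p
               \<and> is_semidirect_product G (derived G (carrier G)) (generate G {x})
               \<and> elementary_abelian p (G\<lparr>carrier := derived G (carrier G)\<rparr>)
               \<and> maximal_subgroup (generate G {x}) G
               \<and> card (generate G {x}) = q
               \<and> carter_subgroup (generate G {x}) G))"
proof -
  interpret group G by fact
  \<comment> \<open>Every nilpotent group lies in the class, so this part of the right-hand side
    holds from the outset.\<close>
  have "\<not> nilpotent_group G" using in_class_nilpotent[OF assms(4,6)] assms(7) by blast
  then show ?thesis
    using proper_subgroups_prime_power_of_subnormal_or_self_normalizing[OF assms(1,3,4,6,7)]
      subnormal_or_self_normalizing_of_proper_subgroups_prime_power[OF assms(4,6)]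
      ex_semidirect_structure[OF assms(6)]
    by blast
qed

end
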